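(* Let $\mathbf k$ be an infinite field, let $\mathcal L\subseteq\mathbb Z^n$ be a sublattice of rank two, and let $I\subseteq S=\mathbf k[x_1,\dots,x_n]$ be a monomial $\mathcal L$-graded ideal. Then $I=in_w(I_{\mathcal L})$ for some $w\in\mathbb Z^n$.
   Context: $S$ is graded by $G=\mathbb Z^n/\mathcal L$ via $\deg(x_i)=e_i+\mathcal L$; $G^+$ is the image of $\mathbb N^n$ in $G$. A homogeneous ideal $I\subseteq S$ is $\mathcal L$-graded if $\dim_{\mathbf k}((S/I)_g)=1$ for all $g\in G^+$; a monomial $\mathcal L$-graded ideal is an $\mathcal L$-graded ideal generated by monomials. For $u\in\mathbb Z^n$ write $u=u^+-u^-$ with $u^+,u^-\in\mathbb N^n$ the positive and negative parts (disjoint supports). The lattice ideal is $I_{\mathcal L}=\langle x^{u^+}-x^{u^-} : u\in\mathcal L\rangle\subseteq S$. For $w\in\mathbb Z^n$, the initial form $in_w(f)$ of a nonzero polynomial $f$ is the sum of those terms $c_ux^u$ of $f$ with $w\cdot u$ maximal, and $in_w(I_{\mathcal L})=\langle in_w(f) : 0\neq f\in I_{\mathcal L}\rangle$. *)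

theory Defs
  imports "HOL-Analysis.Analysis" "HOL-Library.Poly_Mapping"
begin

text \<open>
  The polynomial ring \<open>S = k[x_1, \<dots>, x_n]\<close> is the monoid algebra of \<open>\<nat>^n\<close> over \<open>k\<close>, with the
  variables indexed by a finite type.
\<close>

type_synonym ('k, 'n) mpoly = "(nat ^ 'n) \<Rightarrow>\<^sub>0 'k"

text \<open>
  The submodules of a commutative ring regarded as a module over itself are its ideals, and
  \<open>ideal.span\<close> is the ideal generated by a set.
\<close>

interpretation ideal: module "(*) :: 'a \<Rightarrow> 'a \<Rightarrow> 'a :: comm_ring_1"
  by standard (simp_all add: algebra_simps)

text \<open>
  \<open>zmod.subspace\<close> describes the additive subgroups of \<open>\<int>^n\<close>.
\<close>

interpretation zmod: module "(*s) :: int \<Rightarrow> int ^ 'n \<Rightarrow> int ^ 'n"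
  by standard (simp_all add: vec_eq_iff algebra_simps)

definition has_rank :: "(int ^ 'n) set \<Rightarrow> nat \<Rightarrow> bool" where
  "has_rank L r \<longleftrightarrow> (\<exists>B. finite B \<and> card B = r \<and> zmod.independent B \<and> zmod.span B = L)"

definition monomial :: "nat ^ 'n \<Rightarrow> ('k :: comm_ring_1, 'n) mpoly" where
  "monomial u = Poly_Mapping.single u 1"

definition const :: "'k :: comm_ring_1 \<Rightarrow> ('k, 'n :: finite) mpoly" where
  "const c = Poly_Mapping.single 0 c"

definition int_exp :: "nat ^ 'n \<Rightarrow> int ^ 'n" where
  "int_exp u = (\<chi> i. int (u $ i))"

text \<open>
  Elements of the grading group \<open>G = \<int>^n / L\<close> are represented as cosets of \<open>L\<close>. The degree of
  the monomial with exponent \<open>u\<close> is the sum of \<open>u_i\<close> times the class of \<open>e_i\<close>, i.e. \<open>u + L\<close>.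
\<close>

definition deg :: "(int ^ 'n) set \<Rightarrow> nat ^ 'n \<Rightarrow> (int ^ 'n) set" where
  "deg L u = {int_exp u + l | l. l \<in> L}"

definition G_plus :: "(int ^ 'n) set \<Rightarrow> (int ^ 'n) set set" where
  "G_plus L = range (deg L)"

definition graded_piece ::
    "(int ^ 'n) set \<Rightarrow> (int ^ 'n) set \<Rightarrow> ('k :: comm_ring_1, 'n) mpoly set" where
  "graded_piece L g = {f. \<forall>u \<in> Poly_Mapping.keys f. deg L u = g}"

definition homogeneous_ideal :: "(int ^ 'n) set \<Rightarrow> ('k :: comm_ring_1, 'n) mpoly set \<Rightarrow> bool" where
  "homogeneous_ideal L I \<longleftrightarrow>
    (\<exists>F. (\<forall>f \<in> F. \<exists>g. f \<in> graded_piece L g) \<and> I = ideal.span F)"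

text \<open>
  For a subspace \<open>V\<close> and an ideal \<open>I\<close>, \<open>basis_mod I V B\<close> says that \<open>B \<subseteq> V\<close> is a finite set whose
  residue classes modulo \<open>I\<close> are pairwise distinct and form a \<open>k\<close>-basis of the image
  \<open>(V + I) / I\<close> of \<open>V\<close> in \<open>S / I\<close>. (Distinctness is part of the independence condition, since
  \<open>I\<close> contains \<open>b - b'\<close> whenever \<open>b\<close> and \<open>b'\<close> have the same class.)
  Taking \<open>V = S_g\<close>, this image is \<open>(S / I)_g\<close>.
\<close>

definition basis_mod ::
    "('k :: field, 'n :: finite) mpoly set \<Rightarrow> ('k, 'n) mpoly set \<Rightarrow> ('k, 'n) mpoly set \<Rightarrow> bool" where
  "basis_mod I V B \<longleftrightarrow>
    finite B \<and> B \<subseteq> V \<and>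
    (\<forall>c :: ('k, 'n) mpoly \<Rightarrow> 'k. (\<Sum>b\<in>B. const (c b) * b) \<in> I \<longrightarrow> (\<forall>b\<in>B. c b = 0)) \<and>
    (\<forall>f\<in>V. \<exists>c :: ('k, 'n) mpoly \<Rightarrow> 'k. f - (\<Sum>b\<in>B. const (c b) * b) \<in> I)"

definition has_dim_mod :: "('k :: field, 'n :: finite) mpoly set \<Rightarrow> ('k, 'n) mpoly set \<Rightarrow> nat \<Rightarrow> bool" where
  "has_dim_mod I V d \<longleftrightarrow> (\<exists>B. basis_mod I V B \<and> card B = d)"

definition L_graded_ideal :: "(int ^ 'n) set \<Rightarrow> ('k :: field, 'n) mpoly set \<Rightarrow> bool" where
  "L_graded_ideal L I \<longleftrightarrow>
    homogeneous_ideal L I \<and> (\<forall>g \<in> G_plus L. has_dim_mod I (graded_piece L g) 1)"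

definition monomial_L_graded_ideal ::
    "(int ^ 'n) set \<Rightarrow> ('k :: field, 'n) mpoly set \<Rightarrow> bool" where
  "monomial_L_graded_ideal L I \<longleftrightarrow>
    L_graded_ideal L I \<and> (\<exists>M. I = ideal.span (monomial ` M))"

definition pos_part :: "int ^ 'n \<Rightarrow> nat ^ 'n" where
  "pos_part u = (\<chi> i. nat (u $ i))"

definition neg_part :: "int ^ 'n \<Rightarrow> nat ^ 'n" where
  "neg_part u = (\<chi> i. nat (- u $ i))"

definition lattice_ideal :: "(int ^ 'n) set \<Rightarrow> ('k :: comm_ring_1, 'n) mpoly set" where
  "lattice_ideal L = ideal.span {monomial (pos_part u) - monomial (neg_part u) | u. u \<in> L}"

definition weight :: "int ^ 'n \<Rightarrow> nat ^ 'n \<Rightarrow> int" where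
  "weight w u = (\<Sum>i\<in>UNIV. w $ i * int (u $ i))"

definition initial_form :: "int ^ 'n \<Rightarrow> ('k :: comm_ring_1, 'n) mpoly \<Rightarrow> ('k, 'n) mpoly" where
  "initial_form w f =
    (\<Sum>u \<in> {u \<in> Poly_Mapping.keys f. \<forall>v \<in> Poly_Mapping.keys f. weight w v \<le> weight w u}.
      Poly_Mapping.single u (Poly_Mapping.lookup f u))"

definition initial_ideal ::
    "int ^ 'n \<Rightarrow> ('k :: comm_ring_1, 'n) mpoly set \<Rightarrow> ('k, 'n) mpoly set" where
  "initial_ideal w I = ideal.span {initial_form w f | f. f \<in> I \<and> f \<noteq> 0}"

end

theory Submission
  imports Defs
begin

text \<open>
  The exponents of the monomials outside \<open>I\<close> form a down-closed set with exactly one point in each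
  fiber of the grading. Identify \<open>L\<close> with \<open>\<int>\<^sup>2\<close> and let \<open>D\<close> consist of the nonzero \<open>d\<close> such that
  \<open>x\<close> to the power \<open>d\<^sup>-\<close> is standard; say that \<open>v\<close> beats \<open>v + d\<close>. Fibers become lattice polygons
  with prescribed facet normals, in each of which one point beats all others, and \<open>I = in\<^sub>w(I\<^sub>L)\<close> as
  soon as \<open>w\<close> is positive on \<open>D\<close>. Being generated by its finitely many conformally minimal elements,
  \<open>D\<close> admits such a \<open>w\<close> unless it contains three vectors \<open>a\<close>, \<open>b\<close>, \<open>c\<close> that positively span the plane.

  Take such a triple whose triangle has minimal area. A lattice point of the triangle \<open>0, a, b\<close>
  can be compared with \<open>0\<close>, possibly after replacing it by another point of this triangle, and yields
  a smaller triple if the determinant of \<open>a, b\<close> is the least of the three and exceeds \<open>1\<close>. So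
  \<open>a, b\<close> is a basis. Then \<open>0\<close> and \<open>a + b\<close> are comparable, which again gives a smaller triple unless
  \<open>c = -(a + b)\<close>; but in that case the point chosen in the polygon around \<open>0, a, a + b\<close> would be an
  interior lattice point of a unimodular triangle.
\<close>

section \<open>Planar lattice geometry\<close>

text \<open>
  As a simplification rule, the interpreted fact \<open>a * (b * x) = (a * b) * x\<close> loops with
  \<open>algebra_simps\<close>.
\<close>

declare ideal.scale_scale [simp del]

definition cross :: "int \<times> int \<Rightarrow> int \<times> int \<Rightarrow> int" where
  "cross a b = fst a * snd b - snd a * fst b"

definition app :: "int \<times> int \<Rightarrow> int \<times> int \<Rightarrow> int" where
  "app f v = fst f * fst v + snd f * snd v"

lemma app_simps [simp]:
  "app f 0 = 0" "app f (u + v) = app f u + app f v" "app f (u - v) = app f u - app f v"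
  "app f (- v) = - app f v"
  by (simp_all add: app_def algebra_simps)

lemma cross_simps [simp]:
  "cross (u + v) w = cross u w + cross v w" "cross w (u + v) = cross w u + cross w v"
  "cross (u - v) w = cross u w - cross v w" "cross w (u - v) = cross w u - cross w v"
  "cross (- v) w = - cross v w" "cross w (- v) = - cross w v"
  "cross v v = 0" "cross 0 v = 0" "cross v 0 = 0"
  by (simp_all add: cross_def algebra_simps)

lemma cross_commute: "cross b a = - cross a b"
  by (simp add: cross_def algebra_simps)

text \<open>Cramer's rule: divided by \<open>cross a b\<close>, the numbers \<open>cross v b\<close>
  and \<open>cross a v\<close> are the coordinates of \<open>v\<close> in the basis
  \<open>a\<close>, \<open>b\<close>. The vector identity is tested on a functional
  \<open>f\<close>, the form in which it is applied.\<close>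

lemma cramer: "cross a b * app f v = cross v b * app f a + cross a v * app f b"
  by (simp add: cross_def app_def algebra_simps)

lemma cross_cramer: "cross a b * cross v w = cross v b * cross a w + cross a v * cross b w"
  by (simp add: cross_def algebra_simps)

lemma cross_cancel:
  assumes "cross a b \<noteq> 0" "cross v b = 0" "cross a v = 0"
  shows "v = 0"
proof -
  have "cross a b * fst v = cross v b * fst a + cross a v * fst b"
    "cross a b * snd v = cross v b * snd a + cross a v * snd b"
    by (simp_all add: cross_def algebra_simps)
  then show ?thesis using assms by (simp add: prod_eq_iff)
qed

text \<open>The sublattice spanned by \<open>a\<close> and \<open>b\<close> has index
  \<open>cross a b\<close>, so it misses some lattice vector. Reducing that vector into the
  half-open parallelogram and, if necessary, reflecting it in the centre gives a point of the
  triangle 0, \<open>a\<close>, \<open>b\<close> other than its vertices.\<close>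

lemma lattice_point_in_triangle:
  assumes "2 \<le> cross a b"
  shows "\<exists>e. 0 \<le> cross e b \<and> 0 \<le> cross a e \<and> cross e b + cross a e \<le> cross a b \<and>
    cross e b < cross a b \<and> cross a e < cross a b \<and> e \<noteq> 0"
proof -
  let ?N = "cross a b"
  have "\<exists>v. \<not> (?N dvd cross v b \<and> ?N dvd cross a v)"
  proof (rule ccontr)
    assume "\<not> ?thesis"
    then have dvd: "?N dvd cross v b" "?N dvd cross a v" for v
      by blast+
    from dvd[of "(1, 0)"] dvd[of "(0, 1)"]
    have "?N dvd snd b" "?N dvd fst b" "?N dvd snd a" "?N dvd fst a"
      by (simp_all add: cross_def)
    then have "?N * ?N dvd ?N"
      by (subst (3) cross_def) (intro dvd_diff mult_dvd_mono)
    then have "?N * ?N \<le> ?N"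
      using assms by (intro zdvd_imp_le) auto
    then show False
      using assms by (simp add: mult_le_cancel_left1)
  qed
  then obtain v where v: "\<not> (?N dvd cross v b \<and> ?N dvd cross a v)" by blast
  \<comment> \<open>The integer parts of the coordinates of \<open>v\<close>; subtracting them
    leaves the fractional parts.\<close>
  define m n where "m = cross v b div ?N" and "n = cross a v div ?N"
  define e where "e = (fst v - (m * fst a + n * fst b), snd v - (m * snd a + n * snd b))"
  have "cross e b = cross v b - ?N * m" "cross a e = cross a v - ?N * n"
    unfolding cross_def e_def fst_conv snd_conv by algebra+
  then have e1: "cross e b = cross v b mod ?N" and e2: "cross a e = cross a v mod ?N"
    by (simp_all only: m_def n_def minus_mult_div_eq_mod)
  have "cross e b \<noteq> 0 \<or> cross a e \<noteq> 0"
    using v by (auto simp: e1 e2 dvd_eq_mod_eq_0)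
  moreover have "0 \<le> cross e b" "cross e b < ?N" "0 \<le> cross a e" "cross a e < ?N"
    using assms by (simp_all add: e1 e2)
  ultimately show ?thesis
  proof (cases "cross e b + cross a e \<le> ?N")
    case True
    with \<open>cross e b \<noteq> 0 \<or> cross a e \<noteq> 0\<close> \<open>0 \<le> cross e b\<close> \<open>cross e b < ?N\<close> \<open>0 \<le> cross a e\<close>
      \<open>cross a e < ?N\<close> show ?thesis
      by (intro exI[of _ e]) auto
  next
    case False
    have *: "cross (a + b - e) b = ?N - cross e b" "cross a (a + b - e) = ?N - cross a e"
      by simp_all
    with False \<open>cross e b < ?N\<close> \<open>cross a e < ?N\<close> \<open>0 \<le> cross e b\<close> \<open>0 \<le> cross a e\<close>
    have "cross (a + b - e) b > 0"
      by linarith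
    then have "a + b - e \<noteq> 0"
      by auto
    with * False \<open>cross e b < ?N\<close> \<open>cross a e < ?N\<close> \<open>0 \<le> cross e b\<close> \<open>0 \<le> cross a e\<close>
    show ?thesis
      by (intro exI[of _ "a + b - e"]) auto
  qed
qed

text \<open>Here \<open>s\<close> and \<open>t\<close> are the coordinates of a point in terms of
  two vectors e and a; \<open>pe\<close>, \<open>pa\<close> and \<open>re\<close>, \<open>ra\<close>
  are the values of two functionals at e and a. The second functional keeps the point within the
  edge through e and a, the first keeps it on the side of e of the line through 0 and a.\<close>

lemma triangle_coordinates:
  fixes s t :: real
  assumes "0 \<le> t"
    and "pe \<le> s * pe + t * pa" "s * pe + t * pa < 0" "s * pe + t * pa < pa"
    and "re \<le> s * re + t * ra" "ra \<le> re" "re < 0"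
  shows "0 < s" "s + t \<le> 1"
proof -
  have "t * re \<ge> t * ra"
    using assms by (intro mult_left_mono) auto
  with assms have "(1 - s - t) * re \<le> 0"
    by (simp add: algebra_simps)
  with \<open>re < 0\<close> show st: "s + t \<le> 1"
    by (simp add: mult_le_0_iff)
  show "0 < s"
  proof (rule ccontr)
    assume "\<not> 0 < s"
    then have "s \<le> 0" by simp
    have "pe < 0" "pe < pa"
      using assms by auto
    have "s * pe \<ge> 0"
      using \<open>s \<le> 0\<close> \<open>pe < 0\<close> by (simp add: mult_nonpos_nonpos)
    then have "pa < 0"
      using assms(1,3) by (metis add_nonneg_nonneg mult_nonneg_nonneg not_le)
    then have "(1 - s) * pa \<le> t * pa"
      using st by (intro mult_right_mono_neg) auto
    then have "s * (pe - pa) < 0"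
      using assms(4) by (simp add: algebra_simps)
    moreover have "s * (pe - pa) \<ge> 0"
      using \<open>s \<le> 0\<close> \<open>pe < pa\<close> by (simp add: mult_nonpos_nonpos)
    ultimately show False by simp
  qed
qed

text \<open>Convexity: in coordinates scaled by \<open>n\<close>, the vector a is
  \<open>(n, 0)\<close> and e is \<open>(k, l)\<close>, so a point of the triangle 0, e, a stays in
  the triangle 0, a, b.\<close>

lemma triangle_bounds:
  fixes s t :: real and k l n x y :: int
  assumes "0 < s" "0 \<le> t" "s + t \<le> 1" "0 \<le> k" "0 \<le> l" "k + l \<le> n"
    and x: "x = s * k + t * n" and y: "y = s * l"
  shows "0 \<le> x" "0 \<le> y" "x + y \<le> n"
proof -
  have "0 \<le> real_of_int x" "0 \<le> real_of_int y"
    unfolding x y using assms by (auto intro!: add_nonneg_nonneg mult_nonneg_nonneg)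
  then show "0 \<le> x" "0 \<le> y" by simp_all
  have "s * (k + l) \<le> s * n"
    using assms by (intro mult_left_mono) auto
  moreover have "(s + t) * real_of_int n \<le> 1 * real_of_int n"
    using assms by (intro mult_right_mono) auto
  ultimately have "real_of_int (x + y) \<le> n"
    by (simp add: x y algebra_simps)
  then show "x + y \<le> n" by linarith
qed

lemma real_quotient_combination:
  fixes k :: int
  assumes "0 < k" "k * x = u * v + w * z"
  shows "real_of_int x = u / k * v + w / k * z"
proof -
  have "real_of_int (k * x) = real_of_int (u * v + w * z)"
    using assms(2) by (simp only:)
  with assms(1) show ?thesis
    by (simp add: field_simps)
qed

text \<open>A functional is measured from its lowest vertex of a triangle: \<open>g\<close> and
  \<open>h\<close> are its values at the other two vertices, \<open>m\<close> and \<open>n\<close>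
  the barycentric coordinates of a point there. A value that is nonnegative but below both
  \<open>g\<close> and \<open>h\<close> rules out coordinates of the same weak sign, unless both
  vanish.\<close>

lemma strict_corner_coordinates:
  fixes g h m n :: int
  assumes "0 < g" "0 < h" "0 \<le> m * g + n * h" "m * g + n * h < g" "m * g + n * h < h"
  shows "m = 0 \<and> n = 0 \<or> m < 0 \<and> 0 < n \<or> 0 < m \<and> n < 0"
proof -
  have "\<not> (0 \<le> m \<and> 1 \<le> n)"
  proof
    assume "0 \<le> m \<and> 1 \<le> n"
    then have "0 \<le> m * g" "1 * h \<le> n * h"
      using assms by (auto intro: mult_right_mono)
    with assms show False by linarith
  qed
  moreover have "\<not> (1 \<le> m \<and> 0 \<le> n)"
  proof
    assume "1 \<le> m \<and> 0 \<le> n"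
    then have "0 \<le> n * h" "1 * g \<le> m * g"
      using assms by (auto intro: mult_right_mono)
    with assms show False by linarith
  qed
  moreover have "\<not> (m \<le> 0 \<and> n \<le> - 1)"
  proof
    assume "m \<le> 0 \<and> n \<le> - 1"
    then have "m * g \<le> 0" "n * h < 0"
      using assms by (auto simp: mult_nonpos_nonneg mult_neg_pos)
    with assms show False by linarith
  qed
  moreover have "\<not> (m \<le> - 1 \<and> n \<le> 0)"
  proof
    assume "m \<le> - 1 \<and> n \<le> 0"
    then have "m * g < 0" "n * h \<le> 0"
      using assms by (auto simp: mult_nonpos_nonneg mult_neg_pos)
    with assms show False by linarith
  qed
  ultimately show ?thesis by linarith
qed

text \<open>The inequalities behind \<open>diagonal_comparable\<close>: \<open>x\<close>,
  \<open>y\<close> are the coordinates of the chosen point in the basis a, b, the vector c is the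
  negative of \<open>(k + 1) a + (l + 1) b\<close>, and \<open>p\<close>, \<open>r\<close>,
  \<open>f\<close> collect the constraints from three separating functionals. In terms of a + b and
  a the point has coordinates \<open>y\<close> and \<open>t \<ge> 0\<close>. The signs are narrowed
  down until \<open>x \<le> 0\<close> and \<open>y \<le> 0\<close>, at odds with
  \<open>p\<close>.\<close>

lemma diagonal_contradiction:
  fixes x y :: int
  assumes "y \<le> x" "(x, y) \<noteq> (1, 1)" "0 \<le> k" "0 \<le> l"
    and p: "pa + pb \<le> x * pa + y * pb" "x * pa + y * pb < 0" "x * pa + y * pb < pa"
    and r: "ra + rb \<le> x * ra + y * rb" "x * ra + y * rb < 0" "x * ra + y * rb < rb"
    and f: "0 \<le> x * fa + y * fb" "x * fa + y * fb < fa + fb" "x * fa + y * fb < - (k * fa + l * fb)"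
  shows False
proof -
  define t where "t = x - y"
  have x: "x = y + t" and "0 \<le> t"
    using assms(1) by (auto simp: t_def)
  have neg: "pb < 0" "ra < 0" "pa + pb < 0" "ra + rb < 0" "0 < fa + fb"
    using p r f by linarith+
  have p': "pa + pb \<le> y * (pa + pb) + t * pa" "y * (pa + pb) + t * pa < 0"
    and r': "ra + rb \<le> y * (ra + rb) + t * ra"
    and f': "0 \<le> y * (fa + fb) + t * fa" "y * (fa + fb) + t * fa < fa + fb"
    using p r f by (auto simp: x algebra_simps)
  have "t \<noteq> 0"
  proof
    assume "t = 0"
    with p' have "(1 - y) * (pa + pb) \<le> 0" "y * (pa + pb) < 0"
      by (simp_all add: algebra_simps)
    with neg have "0 \<le> 1 - y" "0 < y"
      by (auto simp: mult_le_0_iff mult_less_0_iff)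
    with x \<open>t = 0\<close> assms(2) show False by auto
  qed
  with \<open>0 \<le> t\<close> have "0 < t" by simp
  have "y \<le> 0"
  proof (rule ccontr)
    assume "\<not> y \<le> 0"
    then have "y * (ra + rb) \<le> ra + rb"
      using mult_right_mono_neg[of 1 y "ra + rb"] neg by simp
    moreover have "t * ra < 0"
      using \<open>0 < t\<close> neg by (simp add: mult_pos_neg)
    ultimately show False using r' by linarith
  qed
  then have "y * (pa + pb) \<ge> 0" "y * (fa + fb) \<le> 0"
    using neg by (auto simp: mult_nonpos_nonpos mult_nonpos_nonneg)
  then have "t * pa < 0" "0 \<le> t * fa"
    using p' f' by linarith+
  then have "pa < 0" "0 \<le> fa"
    using \<open>0 < t\<close> by (auto simp: mult_less_0_iff zero_le_mult_iff)
  have "k * fa + l * fb < 0"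
    using f by linarith
  moreover have "0 \<le> k * fa"
    using \<open>0 \<le> k\<close> \<open>0 \<le> fa\<close> by simp
  ultimately have "l * fb < 0" by linarith
  then have "fb < 0"
    using \<open>0 \<le> l\<close> by (simp add: mult_less_0_iff)
  have "x \<le> 0"
  proof (rule ccontr)
    assume "\<not> x \<le> 0"
    then have "1 - y \<le> t" by (simp add: x)
    then have "(1 - y) * fa \<le> t * fa"
      using \<open>0 \<le> fa\<close> by (intro mult_right_mono)
    moreover have "(1 - y) * (fa + fb) < (1 - y) * fa"
      using \<open>fb < 0\<close> \<open>y \<le> 0\<close> by (intro mult_strict_left_mono) auto
    ultimately show False using f' by (simp add: algebra_simps)
  qed
  then have "0 \<le> x * pa" "0 \<le> y * pb"
    using \<open>y \<le> 0\<close> \<open>pa < 0\<close> neg by (auto simp: mult_nonpos_nonpos)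
  with p show False by linarith
qed

section \<open>Choice in lattice polygons\<close>

text \<open>
  The points \<open>v\<close> such that every \<open>f \<in> F\<close> satisfies \<open>app f x \<le> app f v\<close> for some \<open>x \<in> V\<close> form the smallest
  polygon around \<open>V\<close> with facet normals in \<open>F\<close>.
\<close>

locale planar_choice =
  fixes F D :: "(int \<times> int) set"
  assumes asym: "d \<in> D \<Longrightarrow> - d \<notin> D"
    and down: "d \<in> D \<Longrightarrow> v \<noteq> 0 \<Longrightarrow> (\<And>f. f \<in> F \<Longrightarrow> min 0 (app f d) \<le> app f v) \<Longrightarrow> v \<in> D"
    and choice: "finite V \<Longrightarrow> V \<noteq> {} \<Longrightarrow>
      \<exists>q. (\<forall>f\<in>F. \<exists>x\<in>V. app f x \<le> app f q) \<and> (\<forall>v\<in>V. v \<noteq> q \<longrightarrow> v - q \<in> D)"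
begin

lemma chosen_point:
  assumes "finite V" "V \<noteq> {}"
  obtains q where "\<And>f. f \<in> F \<Longrightarrow> \<exists>x\<in>V. app f x \<le> app f q"
    and "\<And>v. v \<in> V \<Longrightarrow> v \<noteq> q \<Longrightarrow> v - q \<in> D"
  using choice[OF assms] by blast

lemma nonzero: "d \<in> D \<Longrightarrow> d \<noteq> 0"
  using asym[of d] by auto

text \<open>If the chosen point \<open>q\<close> beats \<open>0\<close>, it cannot lie in the polygon in which \<open>0\<close> beats \<open>d\<close>.\<close>

lemma separating_functional:
  assumes "d \<in> D" "- v \<in> D"
  obtains f where "f \<in> F" "app f v < 0" "app f v < app f d"
proof -
  have "v \<notin> D"
    using asym[OF assms(2)] by simp
  moreover have "v \<noteq> 0"
    using nonzero[OF assms(2)] by auto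
  ultimately obtain f where "f \<in> F" "\<not> min 0 (app f d) \<le> app f v"
    using down[OF assms(1)] by blast
  then show ?thesis by (intro that[of f]) auto
qed

text \<open>On the segment from 0 to \<open>d\<close>, every functional takes a value between 0 and
  its value at \<open>d\<close>, so lattice points there inherit membership in
  \<open>D\<close>.\<close>

lemma pos_multiple_down:
  assumes "d \<in> D" "0 < m" "0 < k" "m \<le> k" "\<And>f. k * app f v = m * app f d" "v \<noteq> 0"
  shows "v \<in> D"
proof (rule down[OF assms(1) assms(6)])
  fix f
  show "min 0 (app f d) \<le> app f v"
  proof (cases "0 \<le> app f d")
    case True
    then have "0 \<le> k * app f v"
      using assms(2,5) by simp
    with \<open>0 < k\<close> show ?thesis by (simp add: zero_le_mult_iff)
  next
    case False
    then have "k * app f d \<le> m * app f d"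
      using assms(4) by (intro mult_right_mono_neg) auto
    then have "k * app f d \<le> k * app f v"
      by (simp add: assms(5))
    with \<open>0 < k\<close> show ?thesis by simp
  qed
qed

text \<open>After cancelling common factors, \<open>d\<close> is \<open>k'\<close> times a lattice
  vector and \<open>e\<close> is \<open>m'\<close> times its negative. That vector and its negative
  would then both lie in \<open>D\<close>.\<close>

lemma no_antiparallel:
  assumes "d \<in> D" "e \<in> D" "0 < m" "0 < k" "\<And>f. m * app f d = - (k * app f e)"
  shows False
proof -
  define g where "g = gcd m k"
  obtain m' k' where mk: "m = g * m'" "k = g * k'" "coprime m' k'"
    using gcd_coprime_exists[of m k] \<open>0 < m\<close> unfolding g_def
    by (metis gcd_eq_0_iff less_irrefl mult.commute)
  have "0 < g"
    using \<open>0 < m\<close> by (simp add: g_def)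
  with assms(3,4) mk have pos: "0 < m'" "0 < k'"
    by (auto simp: zero_less_mult_iff)
  have eq: "m' * app f d = - (k' * app f e)" for f
  proof -
    have "g * (m' * app f d) = g * (- (k' * app f e))"
      using assms(5)[of f] by (simp add: mk mult.assoc)
    with \<open>0 < g\<close> show ?thesis by (subst (asm) mult_cancel_left) auto
  qed
  have "k' dvd m' * app f d" for f
    by (simp add: eq)
  then have dvd: "k' dvd app f d" for f
    using mk(3) by (simp add: coprime_commute coprime_dvd_mult_right_iff)
  from dvd[of "(1, 0)"] dvd[of "(0, 1)"] obtain x y where xy: "fst d = k' * x" "snd d = k' * y"
    by (auto simp: app_def elim!: dvdE)
  have d: "k' * app f (x, y) = 1 * app f d" for f
    unfolding app_def xy fst_conv snd_conv by algebra
  have e: "m' * app f (- (x, y)) = 1 * app f e" for f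
  proof -
    have "k' * (m' * app f (x, y)) = m' * app f d"
      using d[of f] by (metis mult.left_commute mult_1)
    then have "k' * (m' * app f (x, y)) = k' * (- app f e)"
      by (simp only: eq mult_minus_right)
    then have "m' * app f (x, y) = - app f e"
      using pos by (subst (asm) mult_cancel_left) auto
    then show ?thesis
      by (simp only: app_simps mult_minus_right mult_1 minus_minus)
  qed
  have "(x, y) \<noteq> 0"
    using nonzero[OF assms(1)] xy by (auto simp: prod_eq_iff)
  then have "(x, y) \<in> D" "- (x, y) \<in> D"
    using pos_multiple_down[OF assms(1) _ _ _ d] pos_multiple_down[OF assms(2) _ _ _ e] pos
    by (auto simp: prod_eq_iff)
  with asym show False by blast
qed

text \<open>The vertices 0, \<open>a\<close>, \<open>a + b\<close> beat each other cyclically, so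
  the point \<open>q\<close> chosen for them is none of them. Three separating functionals then
  force the integral barycentric coordinates of \<open>q\<close> into an impossible sign
  pattern.\<close>

lemma no_zero_sum_triple:
  assumes "a \<in> D" "b \<in> D" "- (a + b) \<in> D" "cross a b = 1"
  shows False
proof -
  let ?V = "{0, a, a + b}"
  obtain q where q: "\<And>f. f \<in> F \<Longrightarrow> \<exists>x\<in>?V. app f x \<le> app f q"
    and beats_V: "\<And>v. v \<in> ?V \<Longrightarrow> v \<noteq> q \<Longrightarrow> v - q \<in> D"
    using chosen_point[of ?V] by (metis finite.emptyI finite.insertI insert_not_empty)
  have "q \<noteq> 0"
  proof
    assume "q = 0"
    moreover have "a + b \<noteq> 0"
      using nonzero[OF assms(3)] by (metis minus_zero)
    ultimately have "a + b \<in> D"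
      using beats_V[of "a + b"] by auto
    with asym assms(3) show False by blast
  qed
  moreover have "q \<noteq> a"
    using beats_V[of 0] asym[OF assms(1)] nonzero[OF assms(1)] by auto
  moreover have "q \<noteq> a + b"
    using beats_V[of a] asym[OF assms(2)] nonzero[OF assms(2)] by auto
  ultimately have "- q \<in> D" "- (q - a) \<in> D" "- (q - (a + b)) \<in> D"
    using beats_V[of 0] beats_V[of a] beats_V[of "a + b"] by auto
  then obtain f g h where f: "f \<in> F" "app f q < 0" "app f q < app f a"
    and g: "g \<in> F" "app g (q - a) < 0" "app g (q - a) < app g b"
    and h: "h \<in> F" "app h (q - (a + b)) < 0" "app h (q - (a + b)) < app h (- (a + b))"
    using separating_functional assms(1-3) by metis
  define x y where "x = cross q b" and "y = cross a q"
  have xy: "app f q = x * app f a + y * app f b" for f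
    using cramer[of a b f q] assms(4) by (simp add: x_def y_def)
  \<comment> \<open>Each functional is smaller at \<open>q\<close> than at two of the vertices, so
    the vertex bounding it from below is the third one.\<close>
  have f': "app f (a + b) \<le> app f q" and g': "0 \<le> app g q" and h': "app h a \<le> app h q"
    using q[OF f(1)] q[OF g(1)] q[OF h(1)] f g h by auto
  text \<open>The barycentric coordinates of \<open>q\<close> are \<open>1 - x\<close>, \<open>x - y\<close> and \<open>y\<close>.\<close>
  have "1 - x = 0 \<and> x - y = 0 \<or> 1 - x < 0 \<and> 0 < x - y \<or> 0 < 1 - x \<and> x - y < 0"
    using f f' by (intro strict_corner_coordinates[of "- app f (a + b)" "- app f b"])
      (auto simp: xy algebra_simps)
  moreover have "x - y = 0 \<and> y = 0 \<or> x - y < 0 \<and> 0 < y \<or> 0 < x - y \<and> y < 0"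
    using g g' by (intro strict_corner_coordinates[of "app g a" "app g (a + b)"])
      (auto simp: xy algebra_simps)
  moreover have "1 - x = 0 \<and> y = 0 \<or> 1 - x < 0 \<and> 0 < y \<or> 0 < 1 - x \<and> y < 0"
    using h h' by (intro strict_corner_coordinates[of "- app h a" "app h b"])
      (auto simp: xy algebra_simps)
  \<comment> \<open>Any two of the three coordinates vanish together or have opposite signs, which
    is impossible for three numbers with sum 1.\<close>
  ultimately show False by linarith
qed

text \<open>The point \<open>q\<close> beats 0 and lies in the polygon around 0 and
  \<open>e\<close>, where \<open>e\<close> is in the triangle 0, \<open>p\<close>, \<open>r\<close>.
  Separating \<open>q\<close> from \<open>p\<close> and from \<open>r\<close> confines it to the
  triangle 0, \<open>e\<close>, \<open>p\<close>. Exchanging \<open>p\<close> and \<open>r\<close>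
  covers the other side of \<open>e\<close>.\<close>

lemma triangle_side:
  fixes s t :: real
  assumes "p \<in> D" "r \<in> D" "- q \<in> D"
    and q: "\<And>f. f \<in> F \<Longrightarrow> 0 \<le> app f q \<or> app f e \<le> app f q"
    and st: "\<And>f. real_of_int (app f q) = s * app f e + t * app f p" "0 \<le> t"
    and e: "\<And>f. n * app f e = k * app f p + l * app f r"
    and n: "0 < n" "0 \<le> k" "0 < l" "k + l \<le> n"
  shows "0 < s" "s + t \<le> 1"
proof -
  obtain f where f: "f \<in> F" "app f q < 0" "app f q < app f p"
    using separating_functional[OF assms(1,3)] .
  obtain g where g: "g \<in> F" "app g q < 0" "app g q < app g r"
    using separating_functional[OF assms(2,3)] .
  have fe: "app f e \<le> app f q" and ge: "app g e \<le> app g q"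
    using q[OF f(1)] q[OF g(1)] f g by auto
  \<comment> \<open>As \<open>e\<close> is a combination of \<open>p\<close> and \<open>r\<close>
    with weights adding up to at most 1 and \<open>g\<close> is negative at \<open>e\<close>, it
    cannot exceed \<open>app g e\<close> at both \<open>p\<close> and \<open>r\<close>.\<close>
  have gp: "app g p \<le> app g e"
  proof (rule ccontr)
    assume "\<not> app g p \<le> app g e"
    then have "k * app g e \<le> k * app g p"
      using n by (intro mult_left_mono) auto
    moreover have "l * app g e < l * app g r"
      using n g ge by (intro mult_strict_left_mono) auto
    moreover have "n * app g e \<le> (k + l) * app g e"
      using n g ge by (intro mult_right_mono_neg) auto
    ultimately show False
      using e[of g] by (simp add: algebra_simps)
  qed
  have "real_of_int (app f e) \<le> s * app f e + t * app f p" "s * app f e + t * app f p < 0"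
    "s * app f e + t * app f p < app f p" "real_of_int (app g e) \<le> s * app g e + t * app g p"
    "real_of_int (app g p) \<le> app g e" "real_of_int (app g e) < 0"
    using f g fe ge gp unfolding st(1)[symmetric] by simp_all
  from triangle_coordinates[OF st(2) this] show "0 < s" "s + t \<le> 1" .
qed

text \<open>A lattice point \<open>e\<close> on an edge through 0 is a fraction of \<open>a\<close>
  or \<open>b\<close> and hence in \<open>D\<close>. Otherwise the point \<open>q\<close> chosen for
  0 and \<open>e\<close> is 0, so that 0 beats \<open>e\<close>, or it beats 0; in the latter case
  \<open>q\<close> lies in the triangle and takes the place of \<open>e\<close>.\<close>

lemma triangle_comparable:
  assumes D: "a \<in> D" "b \<in> D" and N: "2 \<le> cross a b"
  obtains e where "e \<noteq> 0" "0 \<le> cross e b" "0 \<le> cross a e" "cross e b + cross a e \<le> cross a b"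
    "e \<in> D \<and> cross e b < cross a b \<and> cross a e < cross a b \<or> - e \<in> D"
proof -
  note found = that
  obtain e where e: "0 \<le> cross e b" "0 \<le> cross a e" "cross e b + cross a e \<le> cross a b"
    "cross e b < cross a b" "cross a e < cross a b" "e \<noteq> 0"
    using lattice_point_in_triangle[OF N] by blast
  have "cross e b \<noteq> 0 \<or> cross a e \<noteq> 0"
    using cross_cancel[of a b e] e(6) N by auto
  have "e \<in> D" if "cross e b = 0"
    using that e \<open>cross e b \<noteq> 0 \<or> cross a e \<noteq> 0\<close> cramer[of a b _ e]
    by (intro pos_multiple_down[OF D(2), of "cross a e" "cross a b"]) auto
  moreover have "e \<in> D" if "cross a e = 0"
    using that e \<open>cross e b \<noteq> 0 \<or> cross a e \<noteq> 0\<close> cramer[of a b _ e]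
    by (intro pos_multiple_down[OF D(1), of "cross e b" "cross a b"]) auto
  moreover have thesis if pos: "0 < cross e b" "0 < cross a e"
  proof -
    obtain q where q: "\<And>f. f \<in> F \<Longrightarrow> \<exists>x\<in>{0, e}. app f x \<le> app f q"
      and beats: "\<And>v. v \<in> {0, e} \<Longrightarrow> v \<noteq> q \<Longrightarrow> v - q \<in> D"
      using chosen_point[of "{0, e}"] by (metis finite.emptyI finite.insertI insert_not_empty)
    show thesis
    proof (cases "q = 0")
      case True
      with beats[of e] e show thesis by (intro found[of e]) auto
    next
      case False
      with beats[of 0] have "- q \<in> D" by auto
      have qe: "0 \<le> app f q \<or> app f e \<le> app f q" if "f \<in> F" for f
        using q[OF that] by auto
      have cr: "cross a b * app f e = cross e b * app f a + cross a e * app f b"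
        "cross a b * app f e = cross a e * app f b + cross e b * app f a" for f
        using cramer[of a b f e] by simp_all
      have "0 \<le> cross q b \<and> 0 \<le> cross a q \<and> cross q b + cross a q \<le> cross a b"
      proof (cases "0 \<le> cross q e")
        case True
        \<comment> \<open>The coordinates of \<open>q\<close> in the basis \<open>e\<close>,
          \<open>a\<close>, on the side of \<open>a\<close> of the line through \<open>e\<close>; on
          the other side \<open>b\<close> replaces \<open>a\<close>.\<close>
        define s t :: real where "s = cross a q / cross a e" and "t = cross q e / cross a e"
        have q_eq: "real_of_int (app f q) = s * app f e + t * app f a" for f
          unfolding s_def t_def using cramer[of a e f q] pos
          by (intro real_quotient_combination) (simp_all add: add.commute)
        have "0 \<le> t"
          using True pos by (simp add: t_def)
        then have st: "0 < s" "s + t \<le> 1"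
          using triangle_side[OF D \<open>- q \<in> D\<close> qe q_eq _ cr(1) _ e(1) pos(2) e(3)] N by auto
        have "cross a e * cross q b = cross a q * cross e b + cross q e * cross a b"
          unfolding cross_def by algebra
        then have x: "cross q b = s * cross e b + t * cross a b"
          unfolding s_def t_def by (rule real_quotient_combination[OF pos(2)])
        have y: "cross a q = s * cross a e"
          using pos by (simp add: s_def)
        show ?thesis
          using triangle_bounds[OF st(1) \<open>0 \<le> t\<close> st(2) e(1,2,3) x y] by blast
      next
        case False
        define s t :: real where "s = cross q b / cross e b" and "t = cross e q / cross e b"
        have q_eq: "real_of_int (app f q) = s * app f e + t * app f b" for f
          unfolding s_def t_def using cramer[of e b f q] pos
          by (intro real_quotient_combination) simp_all
        have "0 \<le> cross e q"
          using False cross_commute[of e q] by simp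
        then have "0 \<le> t"
          using pos by (simp add: t_def)
        then have st: "0 < s" "s + t \<le> 1"
          using triangle_side[OF D(2,1) \<open>- q \<in> D\<close> qe q_eq _ cr(2) _ e(2) pos(1)] e(3) N by auto
        have "cross e b * cross a q = cross q b * cross a e + cross e q * cross a b"
          unfolding cross_def by algebra
        then have y: "cross a q = s * cross a e + t * cross a b"
          unfolding s_def t_def by (rule real_quotient_combination[OF pos(1)])
        have x: "cross q b = s * cross e b"
          using pos by (simp add: s_def)
        have "cross a e + cross e b \<le> cross a b"
          using e(3) by simp
        from triangle_bounds[OF st(1) \<open>0 \<le> t\<close> st(2) e(2,1) this y x] show ?thesis
          by (simp add: add.commute)
      qed
      with False \<open>- q \<in> D\<close> show thesis by (intro found[of q]) auto
    qed
  qed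
  ultimately show thesis
    using e found[of e] by linarith
qed

text \<open>If the point \<open>q\<close> chosen for 0 and \<open>a + b\<close> is one of the two,
  they are comparable. Otherwise it beats both, and separating it from \<open>a\<close>,
  \<open>b\<close> and \<open>c\<close> yields three functionals excluded by
  \<open>diagonal_contradiction\<close>.\<close>

lemma diagonal_comparable:
  assumes D: "a \<in> D" "b \<in> D" "c \<in> D" and "cross a b = 1" "0 < cross b c" "0 < cross c a"
  shows "a + b \<in> D \<or> - (a + b) \<in> D"
proof (rule ccontr)
  assume not: "\<not> ?thesis"
  obtain q where q: "\<And>f. f \<in> F \<Longrightarrow> \<exists>x\<in>{0, a + b}. app f x \<le> app f q"
    and beats: "\<And>v. v \<in> {0, a + b} \<Longrightarrow> v \<noteq> q \<Longrightarrow> v - q \<in> D"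
    using chosen_point[of "{0, a + b}"] by (metis finite.emptyI finite.insertI insert_not_empty)
  have "a + b \<noteq> 0"
    using \<open>cross a b = 1\<close> by (metis add_eq_0_iff cross_simps(6,7) zero_neq_one neg_equal_zero)
  then have "q \<noteq> 0" "q \<noteq> a + b"
    using not beats[of 0] beats[of "a + b"] by auto
  then have "- q \<in> D" "- (q - (a + b)) \<in> D"
    using beats[of 0] beats[of "a + b"] by auto
  then obtain f g h where f: "f \<in> F" "app f q < 0" "app f q < app f a"
    and g: "g \<in> F" "app g q < 0" "app g q < app g b"
    and h: "h \<in> F" "app h (q - (a + b)) < 0" "app h (q - (a + b)) < app h c"
    using separating_functional D by metis
  define x y where "x = cross q b" and "y = cross a q"
  have xy: "app f q = x * app f a + y * app f b" for f
    using cramer[of a b f q] assms(4) by (simp add: x_def y_def)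
  have c: "app f c = - (cross b c * app f a + cross c a * app f b)" for f
    using cramer[of a b f c] assms(4) cross_commute[of b c] cross_commute[of c a] by simp
  have "(x, y) \<noteq> (1, 1)"
  proof
    assume "(x, y) = (1, 1)"
    then have "cross (q - (a + b)) b = 0" "cross a (q - (a + b)) = 0"
      using assms(4) by (simp_all add: x_def y_def)
    with \<open>q \<noteq> a + b\<close> assms(4) show False
      using cross_cancel[of a b "q - (a + b)"] by auto
  qed
  have f': "app f (a + b) \<le> app f q" and g': "app g (a + b) \<le> app g q" and h': "0 \<le> app h q"
    using q[OF f(1)] q[OF g(1)] q[OF h(1)] f g h by auto
  \<comment> \<open>Exchanging \<open>a\<close> and \<open>b\<close> reduces everything to
    \<open>y \<le> x\<close>. The subtracted 1s come from evaluating \<open>app h\<close> at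
    \<open>q\<close> instead of \<open>q - (a + b)\<close>.\<close>
  show False
  proof (cases "y \<le> x")
    case True
    then show False
      using f f' g g' h h' \<open>(x, y) \<noteq> (1, 1)\<close> assms(5,6)
      by (intro diagonal_contradiction[of y x "cross b c - 1" "cross c a - 1" "app f a" "app f b"
            "app g a" "app g b" "app h a" "app h b"]) (auto simp: xy c algebra_simps)
  next
    case False
    then show False
      using f f' g g' h h' \<open>(x, y) \<noteq> (1, 1)\<close> assms(5,6)
      by (intro diagonal_contradiction[of x y "cross c a - 1" "cross b c - 1" "app g b" "app g a"
            "app f b" "app f a" "app h b" "app h a"]) (auto simp: xy c algebra_simps)
  qed
qed

text \<open>The sum of the three determinants is twice the area of the triangle \<open>a\<close>,
  \<open>b\<close>, \<open>c\<close>. Where antiparallel vectors or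
  \<open>no_zero_sum_triple\<close> give no direct contradiction, one vector is replaced by
  \<open>a + b\<close>, by a lattice point of the triangle 0, \<open>a\<close>, \<open>b\<close>, or
  by the negative of one.\<close>

lemma spanning_triple_descent:
  assumes D: "a \<in> D" "b \<in> D" "c \<in> D"
    and pos: "0 < cross a b" "0 < cross b c" "0 < cross c a"
    and least: "cross a b \<le> cross b c" "cross a b \<le> cross c a"
    and smaller: "\<And>a' b' c'. \<lbrakk>a' \<in> D; b' \<in> D; c' \<in> D; 0 < cross a' b'; 0 < cross b' c'; 0 < cross c' a';
      cross a' b' + cross b' c' + cross c' a' < cross a b + cross b c + cross c a\<rbrakk> \<Longrightarrow> False"
  shows False
proof (cases "cross a b = 1")
  case True
  have ubc: "cross (a + b) b = 1" "cross a (a + b) = 1" "cross (a + b) c = cross b c - cross c a"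
    using True cross_commute[of c a] cross_commute[of b a] by simp_all
  consider "a + b \<in> D" | "- (a + b) \<in> D"
    using diagonal_comparable[OF D True pos(2,3)] by auto
  then show False
  proof cases
    case 1
    \<comment> \<open>Equality would make \<open>c\<close> a negative multiple of
      \<open>a + b\<close>.\<close>
    have "cross b c \<noteq> cross c a"
    proof
      assume eq: "cross b c = cross c a"
      show False
      proof (rule no_antiparallel[OF 1 D(3), of "cross b c" 1])
        show "cross b c * app f (a + b) = - (1 * app f c)" for f
          using cramer[of a b f c] True eq cross_commute[of b c] cross_commute[of c a]
          by (simp add: algebra_simps)
      qed (use pos in auto)
    qed
    then consider "cross c a < cross b c" | "cross b c < cross c a"
      by linarith
    then show False
    proof cases
      assume "cross c a < cross b c"
      then show False
        using smaller[of a "a + b" c] D 1 ubc pos True by simp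
    next
      assume "cross b c < cross c a"
      then show False
        using smaller[of "a + b" b c] D 1 ubc pos True cross_commute[of "a + b" c] by simp
    qed
  next
    case 2
    from no_zero_sum_triple[OF D(1,2) 2 True] show False .
  qed
next
  case False
  with pos have "2 \<le> cross a b" by simp
  then obtain e where e: "e \<noteq> 0" "0 \<le> cross e b" "0 \<le> cross a e"
      "cross e b + cross a e \<le> cross a b"
      "e \<in> D \<and> cross e b < cross a b \<and> cross a e < cross a b \<or> - e \<in> D"
    using triangle_comparable[OF D(1,2)] by blast
  have nz: "cross e b \<noteq> 0 \<or> cross a e \<noteq> 0"
    using cross_cancel[of a b e] e(1) pos by auto
  \<comment> \<open>The sign of \<open>cross e c\<close> decides which vector an \<open>e\<close> in
    \<open>D\<close> replaces: \<open>b\<close> if positive, \<open>a\<close> if negative. If it is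
    zero, \<open>e\<close> and \<open>c\<close> are antiparallel.\<close>
  have ec: "cross a b * cross e c = cross a e * cross b c - cross e b * cross c a"
    using cross_cramer[of a b e c] cross_commute[of c a] by simp
  from e(5) show False
  proof (elim disjE conjE)
    assume "e \<in> D" and lt: "cross e b < cross a b" "cross a e < cross a b"
    consider "cross e c = 0" | "0 < cross e c" | "cross e c < 0"
      by linarith
    then show False
    proof cases
      case 1
      with ec have "cross a e * cross b c = cross e b * cross c a" by simp
      with nz pos have "cross e b \<noteq> 0" by auto
      with e have "0 < cross e b" by simp
      moreover have "cross b c * app f e = - (cross e b * app f c)" for f
        using cramer[of b c f e] 1 cross_commute[of b e] by simp
      ultimately show False
        using no_antiparallel[OF \<open>e \<in> D\<close> D(3) pos(2)] by blast
    next
      case 2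
      have "0 < cross a e"
      proof (rule ccontr)
        assume "\<not> 0 < cross a e"
        with e have "cross a e = 0" by simp
        with ec e pos have "cross a b * cross e c \<le> 0" by simp
        with 2 pos show False by (simp add: mult_le_0_iff)
      qed
      have "cross a b * cross e c < cross a b * cross b c"
      proof -
        have "cross a e * cross b c < cross a b * cross b c"
          using lt pos by (intro mult_strict_right_mono)
        moreover have "0 \<le> cross e b * cross c a"
          using e pos by simp
        ultimately show ?thesis using ec by linarith
      qed
      then have "cross e c < cross b c"
        using pos by simp
      then show False
        using smaller[of a e c] D \<open>e \<in> D\<close> 2 \<open>0 < cross a e\<close> pos lt by simp
    next
      case 3
      have "0 < cross e b"
      proof (rule ccontr)
        assume "\<not> 0 < cross e b"
        with e have "cross e b = 0" by simp
        with ec e pos have "0 \<le> cross a b * cross e c" by simp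
        with 3 pos show False by (simp add: zero_le_mult_iff)
      qed
      have "cross a b * cross c e < cross a b * cross c a"
      proof -
        have "cross e b * cross c a < cross a b * cross c a"
          using lt pos by (intro mult_strict_right_mono)
        moreover have "0 \<le> cross a e * cross b c"
          using e pos by simp
        ultimately show ?thesis using ec cross_commute[of e c] by simp
      qed
      then have "cross c e < cross c a"
        using pos by simp
      then show False
        using smaller[of e b c] D \<open>e \<in> D\<close> 3 \<open>0 < cross e b\<close> pos lt cross_commute[of e c] by simp
    qed
  next
    assume "- e \<in> D"
    have "cross e b \<noteq> 0"
    proof
      assume 0: "cross e b = 0"
      with nz e have "0 < cross a e" by simp
      then show False
        using no_antiparallel[OF \<open>- e \<in> D\<close> D(2) pos(1), of "cross a e"] cramer[of a b _ e] 0
        by simp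
    qed
    moreover have "cross a e \<noteq> 0"
    proof
      assume 0: "cross a e = 0"
      with nz e have "0 < cross e b" by simp
      then show False
        using no_antiparallel[OF \<open>- e \<in> D\<close> D(1) pos(1), of "cross e b"] cramer[of a b _ e] 0
        by simp
    qed
    \<comment> \<open>With \<open>- e\<close> in place of \<open>c\<close> the sum is at most
      \<open>2 * cross a b\<close>, less than before because \<open>cross a b\<close> is the least
      determinant.\<close>
    ultimately show False
      using smaller[of a b "- e"] D \<open>- e \<in> D\<close> e pos least cross_commute[of e b] cross_commute[of a e]
      by simp
  qed
qed

text \<open>Descent on the area; a cyclic rotation puts the least determinant first.\<close>

lemma no_spanning_triple:
  assumes "a \<in> D" "b \<in> D" "c \<in> D" "0 < cross a b" "0 < cross b c" "0 < cross c a"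
  shows False
  using assms
proof (induction "nat (cross a b + cross b c + cross c a)" arbitrary: a b c rule: less_induct)
  case less
  have smaller: False if "a' \<in> D" "b' \<in> D" "c' \<in> D" "0 < cross a' b'" "0 < cross b' c'" "0 < cross c' a'"
    "cross a' b' + cross b' c' + cross c' a' < cross a b + cross b c + cross c a" for a' b' c'
    using less.hyps[of a' b' c'] that less.prems by simp
  consider "cross a b \<le> cross b c" "cross a b \<le> cross c a"
    | "cross b c \<le> cross c a" "cross b c \<le> cross a b"
    | "cross c a \<le> cross a b" "cross c a \<le> cross b c"
    by linarith
  then show False
  proof cases
    case 1
    show False
      by (rule spanning_triple_descent[OF less.prems 1]) (rule smaller)
  next
    case 2
    show False
      by (rule spanning_triple_descent[OF less.prems(2,3,1,5,6,4) 2], rule smaller)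
        (assumption+, linarith)
  next
    case 3
    show False
      by (rule spanning_triple_descent[OF less.prems(3,1,2,6,4,5) 3], rule smaller)
        (assumption+, linarith)
  qed
qed

end


section \<open>Functionals that are positive on the comparison vectors\<close>

text \<open>Orthogonal decomposition of \<open>d\<close> along \<open>a\<close>. It replaces
  Cramer's rule when the two boundary vectors of a cone are parallel.\<close>

lemma app_cross: "app a a * cross d v = app a v * cross d a + cross a v * app a d"
  unfolding app_def cross_def by algebra

text \<open>Without antiparallel pairs and spanning triples, the vectors lie in a pointed cone with
  clockwise boundary ray \<open>a\<close> and counterclockwise boundary ray \<open>b\<close>. An
  added vector \<open>d\<close> lies inside or replaces one of the rays; violating both bounds would
  make \<open>a\<close>, \<open>b\<close>, \<open>d\<close> a spanning triple, or contradict the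
  signs if \<open>a\<close> and \<open>b\<close> are parallel.\<close>

lemma extreme_rays:
  assumes "finite G" "G \<noteq> {}"
    and parallel: "\<And>d e. d \<in> G \<Longrightarrow> e \<in> G \<Longrightarrow> cross d e = 0 \<Longrightarrow> 0 < app d e"
    and triple: "\<And>a b c. a \<in> G \<Longrightarrow> b \<in> G \<Longrightarrow> c \<in> G \<Longrightarrow> 0 < cross a b \<Longrightarrow> 0 < cross b c \<Longrightarrow> \<not> 0 < cross c a"
  shows "\<exists>a\<in>G. \<exists>b\<in>G. \<forall>v\<in>G. 0 \<le> cross a v \<and> 0 \<le> cross v b"
  using assms
proof (induction rule: finite_ne_induct)
  case (singleton d)
  then show ?case by simp
next
  case (insert d G)
  have "\<exists>a\<in>G. \<exists>b\<in>G. \<forall>v\<in>G. 0 \<le> cross a v \<and> 0 \<le> cross v b"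
  proof (rule insert.IH)
    show "0 < app u v" if "u \<in> G" "v \<in> G" "cross u v = 0" for u v
      using insert.prems(1)[of u v] that by simp
    show "\<not> 0 < cross w u" if "u \<in> G" "v \<in> G" "w \<in> G" "0 < cross u v" "0 < cross v w" for u v w
      using insert.prems(2)[of u v w] that by simp
  qed
  then obtain a b where ab: "a \<in> G" "b \<in> G"
    and v: "\<And>v. v \<in> G \<Longrightarrow> 0 \<le> cross a v \<and> 0 \<le> cross v b"
    by blast
  have pos: "0 < app a a" "0 < app b b"
    using ab insert.prems(1)[of a a] insert.prems(1)[of b b] by auto
  \<comment> \<open>If \<open>a\<close> and \<open>b\<close> are parallel, the cone is a single ray
    containing all of \<open>G\<close>.\<close>
  have par: "cross a v = 0 \<and> cross v b = 0 \<and> 0 < app a v \<and> 0 < app b v" if "cross a b = 0" "v \<in> G" for v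
  proof -
    have "0 < app a b"
      using ab insert.prems(1)[of a b] that by auto
    have "app a a * cross v b = app a b * cross v a"
      using app_cross[of a v b] that by simp
    moreover have "0 \<le> app a a * cross v b"
      using v[OF \<open>v \<in> G\<close>] pos by simp
    ultimately have "0 \<le> cross v a"
      using \<open>0 < app a b\<close> by (simp add: zero_le_mult_iff)
    then have "cross a v = 0"
      using v[OF \<open>v \<in> G\<close>] cross_commute[of a v] by simp
    moreover from this have "cross v b = 0"
      using \<open>app a a * cross v b = app a b * cross v a\<close> cross_commute[of a v] pos by simp
    ultimately show ?thesis
      using insert.prems(1)[of a v] insert.prems(1)[of b v] ab that cross_commute[of v b] by auto
  qed
  have "0 \<le> cross a b"
    using v ab by blast
  consider "0 \<le> cross a d" "0 \<le> cross d b" | "cross a d < 0" "0 \<le> cross d b"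
    | "0 \<le> cross a d" "cross d b < 0" | "cross a d < 0" "cross d b < 0"
    by linarith
  then show ?case
  proof cases
    case 1
    with ab v show ?thesis by (intro bexI[of _ a] bexI[of _ b]) auto
  next
    case 2
    have "0 \<le> cross d u" if "u \<in> G" for u
    proof (cases "cross a b = 0")
      case True
      then have "app a a * cross d u = app a u * cross d a"
        using app_cross[of a d u] par[OF True that] by simp
      moreover have "0 \<le> app a u * cross d a"
        using par[OF True that] 2 cross_commute[of d a] by (intro mult_nonneg_nonneg) auto
      ultimately have "0 \<le> app a a * cross d u"
        by (simp only:)
      then show ?thesis
        using pos by (simp add: zero_le_mult_iff)
    next
      case False
      have "0 \<le> cross d b * cross a u" "0 \<le> cross a d * cross b u"
        using 2 v[OF that] cross_commute[of b u] by (auto simp: mult_nonpos_nonneg)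
      then have "0 \<le> cross a b * cross d u"
        using cross_cramer[of a b d u] by simp
      then show ?thesis
        using False \<open>0 \<le> cross a b\<close> by (simp add: zero_le_mult_iff)
    qed
    with ab v 2 show ?thesis by (intro bexI[of _ d] bexI[of _ b]) auto
  next
    case 3
    have "0 \<le> cross u d" if "u \<in> G" for u
    proof (cases "cross a b = 0")
      case True
      then have "app b b * cross d u = app b u * cross d b"
        using app_cross[of b d u] par[OF True that] cross_commute[of b u] by simp
      moreover have "app b u * cross d b \<le> 0"
        using par[OF True that] 3 by (simp add: mult_nonneg_nonpos)
      ultimately have "app b b * cross d u \<le> 0"
        by (simp only:)
      then have "cross d u \<le> 0"
        using pos by (simp add: mult_le_0_iff)
      then show ?thesis
        using cross_commute[of d u] by simp
    next
      case False
      have "0 \<le> cross b d"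
        using 3 cross_commute[of b d] by simp
      then have "0 \<le> cross u b * cross a d" "0 \<le> cross a u * cross b d"
        using 3 v[OF that] by simp_all
      then have "0 \<le> cross a b * cross u d"
        using cross_cramer[of a b u d] by simp
      then show ?thesis
        using False \<open>0 \<le> cross a b\<close> by (simp add: zero_le_mult_iff)
    qed
    with ab v 3 show ?thesis by (intro bexI[of _ a] bexI[of _ d]) auto
  next
    case 4
    show ?thesis
    proof (cases "cross a b = 0")
      case True
      then have "app a a * cross d b = app a b * cross d a"
        using app_cross[of a d b] by simp
      moreover have "app a a * cross d b < 0"
        using pos 4 by (simp add: mult_pos_neg)
      moreover have "0 < app a b * cross d a"
        using par[OF True ab(2)] 4 cross_commute[of d a] by (intro mult_pos_pos) auto
      ultimately show ?thesis by simp
    next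
      case False
      with \<open>0 \<le> cross a b\<close> show ?thesis
        using insert.prems(2)[of a b d] ab 4 cross_commute[of b d] cross_commute[of d a] by simp
    qed
  qed
qed

text \<open>On the cone with boundary rays \<open>a\<close> and \<open>b\<close>, the linear
  function \<open>cross a v + cross v b\<close> of \<open>v\<close> vanishes only at 0. If the cone
  is a single ray, \<open>a\<close> itself serves as the functional.\<close>

lemma positive_functional_finite:
  assumes "finite G"
    and parallel: "\<And>d e. d \<in> G \<Longrightarrow> e \<in> G \<Longrightarrow> cross d e = 0 \<Longrightarrow> 0 < app d e"
    and triple: "\<And>a b c. a \<in> G \<Longrightarrow> b \<in> G \<Longrightarrow> c \<in> G \<Longrightarrow> 0 < cross a b \<Longrightarrow> 0 < cross b c \<Longrightarrow> \<not> 0 < cross c a"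
  shows "\<exists>w. \<forall>d\<in>G. 0 < app w d"
proof (cases "G = {}")
  case False
  have "\<exists>a\<in>G. \<exists>b\<in>G. \<forall>v\<in>G. 0 \<le> cross a v \<and> 0 \<le> cross v b"
    by (rule extreme_rays[OF assms(1) False]) (rule parallel triple; assumption)+
  then obtain a b where ab: "a \<in> G" "b \<in> G"
    and v: "\<And>v. v \<in> G \<Longrightarrow> 0 \<le> cross a v \<and> 0 \<le> cross v b"
    by blast
  show ?thesis
  proof (cases "cross a b = 0")
    case True
    have "cross a v = 0" if "v \<in> G" for v
    proof -
      have "app a a * cross v b = app a b * cross v a"
        using app_cross[of a v b] True by simp
      moreover have "0 \<le> app a a * cross v b"
        using v[OF that] parallel[OF ab(1) ab(1)] by simp
      ultimately have "0 \<le> cross v a"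
        using parallel[OF ab True] by (simp add: zero_le_mult_iff)
      then show ?thesis
        using v[OF that] cross_commute[of a v] by simp
    qed
    then show ?thesis
      using parallel[OF ab(1)] by blast
  next
    case False
    have "0 < cross a d + cross d b" if "d \<in> G" for d
    proof (rule ccontr)
      assume "\<not> ?thesis"
      then have "cross a d = 0" "cross d b = 0"
        using v[OF that] by auto
      then have "d = 0"
        using cross_cancel[OF False] by blast
      then show False
        using parallel[OF that that] by simp
    qed
    moreover have "app (snd b - snd a, fst a - fst b) d = cross a d + cross d b" for d
      by (simp add: app_def cross_def algebra_simps)
    ultimately show ?thesis
      by (intro exI[of _ "(snd b - snd a, fst a - fst b)"]) auto
  qed
qed simp

section \<open>Dickson's lemma for sequences\<close>

lemma nat_mono_subseq:
  fixes f :: "nat \<Rightarrow> nat"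
  shows "\<exists>r :: nat \<Rightarrow> nat. strict_mono r \<and> mono (\<lambda>n. f (r n))"
proof -
  obtain s :: "nat \<Rightarrow> nat" where s: "strict_mono s" "monoseq (\<lambda>n. f (s n))"
    using seq_monosub[of f] by blast
  show ?thesis
  proof (cases "mono (\<lambda>n. f (s n))")
    case False
    then have dec: "antimono (\<lambda>n. f (s n))"
      using s(2) by (auto simp: monoseq_iff)
    \<comment> \<open>A nonincreasing sequence of natural numbers is constant from the place where
      its minimum is attained.\<close>
    define N where "N = (ARG_MIN (\<lambda>n. f (s n)) n. True)"
    have "f (s N) \<le> f (s n)" for n
      unfolding N_def by (rule arg_min_nat_le) simp
    then have "f (s (N + n)) = f (s N)" for n
      using antimonoD[OF dec, of N "N + n"] by (simp add: le_antisym)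
    with s(1) show ?thesis
      by (intro exI[of _ "\<lambda>n. s (N + n)"]) (auto simp: strict_mono_def)
  qed (use s in blast)
qed

text \<open>The coordinates are made monotone one after the other; passing to a further subsequence
  keeps the earlier ones monotone.\<close>

lemma dickson_subseq:
  fixes h :: "nat \<Rightarrow> 'j \<Rightarrow> nat"
  assumes "finite J"
  shows "\<exists>r :: nat \<Rightarrow> nat. strict_mono r \<and> (\<forall>j\<in>J. mono (\<lambda>n. h (r n) j))"
  using assms
proof induction
  case empty
  show ?case by (auto intro: exI[of _ id] simp: strict_mono_def)
next
  case (insert j J)
  then obtain r :: "nat \<Rightarrow> nat" where r: "strict_mono r" "\<forall>j\<in>J. mono (\<lambda>n. h (r n) j)"
    by blast
  obtain s :: "nat \<Rightarrow> nat" where s: "strict_mono s" "mono (\<lambda>n. h (r (s n)) j)"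
    using nat_mono_subseq[of "\<lambda>n. h (r n) j"] by blast
  have "strict_mono (\<lambda>n. r (s n))"
    using r(1) s(1) by (simp add: strict_mono_def)
  moreover have "mono (\<lambda>n. h (r (s n)) i)" if "i \<in> J" for i
    using r(2) that s(1) by (auto simp: mono_def strict_mono_less_eq)
  ultimately show ?case
    using s(2) by (intro exI[of _ "\<lambda>n. r (s n)"]) auto
qed

section \<open>Positivity on \<open>D\<close> from its conformally minimal elements\<close>

context planar_choice
begin

lemma parallel_imp_same_direction:
  assumes "d \<in> D" "e \<in> D" "cross d e = 0"
  shows "0 < app d e"
proof (rule ccontr)
  assume "\<not> ?thesis"
  then have "app d e \<le> 0" by simp
  have nz: "d \<noteq> 0" "e \<noteq> 0"
    using nonzero assms by auto
  have sq: "0 < app d d"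
    using nz(1) by (simp add: app_def prod_eq_iff sum_squares_gt_zero_iff)
  have "app d d * app f e = app d e * app f d + cross d e * (fst d * snd f - snd d * fst f)" for f
    unfolding app_def cross_def by algebra
  then have eq: "app d d * app f e = app d e * app f d" for f
    using assms(3) by simp
  have "app d e \<noteq> 0"
  proof
    assume "app d e = 0"
    with eq have "app d d * app f e = 0" for f
      by simp
    with sq have "app f e = 0" for f
      by (metis less_irrefl mult_eq_0_iff)
    from this[of "(1, 0)"] this[of "(0, 1)"] nz(2) show False
      by (simp add: app_def prod_eq_iff)
  qed
  with \<open>app d e \<le> 0\<close> have "0 < - app d e" by simp
  then show False
    using no_antiparallel[OF assms(2,1) sq, of "- app d e"] eq by simp
qed

text \<open>The conformal order of Graver bases, in the coordinates given by \<open>F\<close>.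
  Truncation by \<open>nat\<close> extracts positive and negative parts, so that agreement of signs
  is included.\<close>

definition conformal :: "int \<times> int \<Rightarrow> int \<times> int \<Rightarrow> bool" where
  "conformal e d \<longleftrightarrow> (\<forall>f\<in>F. nat (app f e) \<le> nat (app f d) \<and> nat (- app f e) \<le> nat (- app f d))"

text \<open>An infinite set of pairwise incomparable vectors would contradict Dickson's
  lemma.\<close>

lemma finite_conformal_minimal:
  assumes "finite F"
  shows "finite {d \<in> D. \<forall>e\<in>D. conformal e d \<longrightarrow> e = d}" (is "finite ?G")
proof (rule ccontr)
  assume "infinite ?G"
  then obtain x :: "nat \<Rightarrow> int \<times> int" where x: "inj x" "range x \<subseteq> ?G"
    using infinite_countable_subset by blast
  \<comment> \<open>The positive and negative parts of all coordinates, as one tuple indexed by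
    \<open>F\<close> and a boolean.\<close>
  define h where "h n = (\<lambda>(f, b). nat (if b then app f (x n) else - app f (x n)))" for n
  obtain r :: "nat \<Rightarrow> nat" where r: "strict_mono r" "\<And>j. j \<in> F \<times> UNIV \<Longrightarrow> mono (\<lambda>n. h (r n) j)"
    using dickson_subseq[of "F \<times> UNIV" h] assms by (metis finite_SigmaI finite_code)
  have "h (r 0) (f, b) \<le> h (r 1) (f, b)" if "f \<in> F" for f b
    using monoD[OF r(2), of "(f, b)" 0 1] that by simp
  from this[of _ True] this[of _ False] have "conformal (x (r 0)) (x (r 1))"
    by (simp add: conformal_def h_def)
  with x have "x (r 0) = x (r 1)" by blast
  with x(1) have "r 0 = r 1" by (simp add: inj_eq)
  with r(1) show False by (simp add: strict_mono_eq)
qed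

text \<open>A \<open>d\<close> that is not minimal is a conformal sum of \<open>e\<close> and
  \<open>d - e\<close>, both in \<open>D\<close> and smaller, so positivity on the finitely many
  minimal elements propagates by additivity.\<close>

lemma positive_functional:
  assumes fin: "finite F" and separating: "\<And>v. \<forall>f\<in>F. app f v = 0 \<Longrightarrow> v = 0"
  obtains w where "\<And>d. d \<in> D \<Longrightarrow> 0 < app w d"
proof -
  let ?G = "{d \<in> D. \<forall>e\<in>D. conformal e d \<longrightarrow> e = d}"
  obtain w where w: "\<And>d. d \<in> ?G \<Longrightarrow> 0 < app w d"
    using positive_functional_finite[OF finite_conformal_minimal[OF fin]]
      parallel_imp_same_direction no_spanning_triple by blast
  \<comment> \<open>The 1-norm in the coordinates \<open>F\<close>: additive on conformal sums, and
    positive on \<open>D\<close> by \<open>separating\<close>.\<close>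
  define size where "size d = (\<Sum>f\<in>F. nat \<bar>app f d\<bar>)" for d
  have size_pos: "0 < size d" if "d \<in> D" for d
  proof (rule ccontr)
    assume "\<not> 0 < size d"
    with fin have "\<forall>f\<in>F. app f d = 0"
      by (simp add: size_def)
    with separating nonzero[OF that] show False by blast
  qed
  have "0 < app w d" if "d \<in> D" for d
    using that
  proof (induction "size d" arbitrary: d rule: less_induct)
    case less
    show ?case
    proof (cases "d \<in> ?G")
      case True
      then show ?thesis by (rule w)
    next
      case False
      with less.prems obtain e where e: "e \<in> D" "conformal e d" "e \<noteq> d"
        by blast
      have "d - e \<in> D"
      proof (rule down[OF less.prems])
        show "min 0 (app f d) \<le> app f (d - e)" if "f \<in> F" for f
          using e(2) that by (auto simp: conformal_def min_def)
      qed (use e in simp)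
      have "nat \<bar>app f d\<bar> = nat \<bar>app f e\<bar> + nat \<bar>app f (d - e)\<bar>" if "f \<in> F" for f
      proof -
        have "nat (app f e) \<le> nat (app f d)" "nat (- app f e) \<le> nat (- app f d)"
          using e(2) that by (auto simp: conformal_def)
        then show ?thesis
          unfolding app_simps by arith
      qed
      then have "size d = size e + size (d - e)"
        by (simp add: size_def sum.distrib del: app_simps)
      then have "0 < app w e" "0 < app w (d - e)"
        using less.hyps[of e] less.hyps[of "d - e"] e(1) \<open>d - e \<in> D\<close> size_pos
        by (simp_all del: app_simps)
      then show ?thesis by simp
    qed
  qed
  with that show thesis by blast
qed

end


section \<open>Monomial ideals\<close>

lemma const_mult_monomial: "const c * monomial u = Poly_Mapping.single u c"
  by (simp add: const_def monomial_def mult_single)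

lemma monomial_add: "monomial (u + v) = monomial u * monomial v"
  by (simp add: monomial_def mult_single)

lemma sum_single: "(\<Sum>u\<in>Poly_Mapping.keys f. Poly_Mapping.single u (Poly_Mapping.lookup f u)) = f"
  by (rule poly_mapping_eqI)
    (simp add: lookup_sum lookup_single when_def in_keys_iff sum.delta)

lemma sum_monomials: "(\<Sum>u\<in>Poly_Mapping.keys f. const (Poly_Mapping.lookup f u) * monomial u) = f"
  by (simp add: const_mult_monomial sum_single)

text \<open>The polynomials all of whose exponents dominate an element of \<open>M\<close> form an
  ideal containing the generators.\<close>

lemma keys_span_monomials:
  fixes f :: "('k :: comm_ring_1, 'n :: finite) mpoly"
  assumes "f \<in> ideal.span (monomial ` M)" "u \<in> Poly_Mapping.keys f"
  shows "\<exists>m\<in>M. m \<le> u"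
proof -
  let ?S = "{f :: ('k, 'n) mpoly. \<forall>u\<in>Poly_Mapping.keys f. \<exists>m\<in>M. m \<le> u}"
  have "ideal.subspace ?S"
  proof (rule ideal.subspaceI)
    show "f + g \<in> ?S" if "f \<in> ?S" "g \<in> ?S" for f g
      using that Poly_Mapping.keys_add[of f g] by auto
    show "c * f \<in> ?S" if "f \<in> ?S" for c f
    proof (clarify)
      fix u
      assume "u \<in> Poly_Mapping.keys (c * f)"
      then obtain a b where ab: "u = a + b" "b \<in> Poly_Mapping.keys f"
        using keys_mult[of c f] by auto
      with that obtain m where "m \<in> M" "m \<le> b" by auto
      with ab show "\<exists>m\<in>M. m \<le> u"
        by (auto simp: less_eq_vec_def intro!: bexI[of _ m] trans_le_add2)
    qed
  qed simp
  moreover have "monomial ` M \<subseteq> ?S"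
    by (auto simp: monomial_def)
  ultimately show ?thesis
    using ideal.span_minimal assms by blast
qed

lemma monomial_mem_upward:
  fixes I :: "('k :: comm_ring_1, 'n :: finite) mpoly set"
  assumes "ideal.subspace I" "monomial m \<in> I" "m \<le> u"
  shows "monomial u \<in> I"
proof -
  have "u = (u - m) + m"
    using assms(3) by (simp add: vec_eq_iff less_eq_vec_def)
  then have "monomial u = (monomial (u - m) * monomial m :: ('k, 'n) mpoly)"
    by (metis monomial_add)
  then show ?thesis
    using ideal.subspace_scale[OF assms(1,2)] by simp
qed

lemma mem_if_monomials_mem:
  assumes "ideal.subspace I" "\<And>u. u \<in> Poly_Mapping.keys f \<Longrightarrow> monomial u \<in> I"
  shows "f \<in> I"
  by (subst sum_monomials[symmetric])
    (intro ideal.subspace_sum ideal.subspace_scale assms)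

lemma monomial_mem_if_key:
  assumes "I = ideal.span (monomial ` M)" "f \<in> I" "u \<in> Poly_Mapping.keys f"
  shows "monomial u \<in> I"
proof -
  obtain m where "m \<in> M" "m \<le> u"
    using keys_span_monomials assms by blast
  with assms(1) show ?thesis
    by (intro monomial_mem_upward[of I m u]) (auto intro: ideal.span_base)
qed

section \<open>Standard monomials of a lattice-graded monomial ideal\<close>

lemma deg_eq_iff:
  assumes "zmod.subspace L"
  shows "deg L u = deg L v \<longleftrightarrow> int_exp u - int_exp v \<in> L"
proof
  assume eq: "deg L u = deg L v"
  have "int_exp u \<in> deg L u"
    using zmod.subspace_0[OF assms] unfolding deg_def by force
  with eq show "int_exp u - int_exp v \<in> L"
    by (auto simp: deg_def)
next
  assume *: "int_exp u - int_exp v \<in> L"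
  have "\<exists>l'. int_exp u + l = int_exp v + l' \<and> l' \<in> L" if "l \<in> L" for l
    using zmod.subspace_add[OF assms * that]
    by (intro exI[of _ "int_exp u - int_exp v + l"]) simp
  moreover have "\<exists>l'. int_exp v + l = int_exp u + l' \<and> l' \<in> L" if "l \<in> L" for l
    using zmod.subspace_diff[OF assms that *]
    by (intro exI[of _ "l - (int_exp u - int_exp v)"]) simp
  ultimately show "deg L u = deg L v"
    unfolding deg_def by blast
qed

lemma monomial_in_graded_piece: "monomial u \<in> graded_piece L g \<longleftrightarrow> deg L u = g"
  by (simp add: graded_piece_def monomial_def)

text \<open>If \<open>I\<close> contained all monomials of this degree, it would contain the basis
  element of the graded piece, against independence.\<close>

lemma standard_exists:
  fixes I :: "('k :: field, 'n :: finite) mpoly set"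
  assumes "monomial_L_graded_ideal L I"
  shows "\<exists>s. monomial s \<notin> I \<and> deg L s = deg L u"
proof -
  obtain M where I: "I = ideal.span (monomial ` M)"
    using assms by (auto simp: monomial_L_graded_ideal_def)
  have "has_dim_mod I (graded_piece L (deg L u)) 1"
    using assms by (simp add: monomial_L_graded_ideal_def L_graded_ideal_def G_plus_def)
  then obtain b where b: "basis_mod I (graded_piece L (deg L u)) {b}"
    by (auto simp: has_dim_mod_def card_1_singleton_iff)
  have "b \<notin> I"
  proof
    assume "b \<in> I"
    then have "const 1 * b \<in> I"
      by (simp add: I ideal.span_scale)
    moreover have "const (c b) * b \<in> I \<longrightarrow> c b = 0" for c :: "_ \<Rightarrow> 'k"
      using b by (simp add: basis_mod_def)
    from this[of "\<lambda>_. 1"] have "const 1 * b \<in> I \<longrightarrow> (1 :: 'k) = 0" .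
    ultimately show False by simp
  qed
  then obtain s where "s \<in> Poly_Mapping.keys b" "monomial s \<notin> I"
    using mem_if_monomials_mem[of I b] I by auto
  with b show ?thesis
    by (auto simp: basis_mod_def graded_piece_def)
qed

text \<open>Modulo \<open>I\<close> both monomials are multiples of one basis element. Eliminating
  it leaves an element of \<open>I\<close> in which \<open>t\<close> occurs, and a monomial ideal
  contains every monomial of its elements.\<close>

lemma standard_unique:
  fixes I :: "('k :: field, 'n :: finite) mpoly set"
  assumes "monomial_L_graded_ideal L I" "monomial s \<notin> I" "monomial t \<notin> I" "deg L s = deg L t"
  shows "s = t"
proof (rule ccontr)
  assume "s \<noteq> t"
  obtain M where I: "I = ideal.span (monomial ` M)"
    using assms(1) by (auto simp: monomial_L_graded_ideal_def)
  have "has_dim_mod I (graded_piece L (deg L t)) 1"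
    using assms(1) by (simp add: monomial_L_graded_ideal_def L_graded_ideal_def G_plus_def)
  then obtain b where b: "basis_mod I (graded_piece L (deg L t)) {b}"
    by (auto simp: has_dim_mod_def card_1_singleton_iff)
  have *: "\<exists>c. f - const c * b \<in> I" if "f \<in> graded_piece L (deg L t)" for f
    using b that by (auto simp: basis_mod_def)
  obtain c where c: "monomial s - const c * b \<in> I"
    using *[of "monomial s"] assms(4) by (auto simp: monomial_in_graded_piece)
  obtain d where d: "monomial t - const d * b \<in> I"
    using *[of "monomial t"] by (auto simp: monomial_in_graded_piece)
  have "c \<noteq> 0"
    using c assms(2) by (auto simp: const_def)
  have "const d * (monomial s - const c * b) - const c * (monomial t - const d * b) \<in> I"
    using ideal.span_diff[OF ideal.span_scale[OF c[unfolded I]] ideal.span_scale[OF d[unfolded I]]]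
    unfolding I .
  also have "const d * (monomial s - const c * b) - const c * (monomial t - const d * b)
      = Poly_Mapping.single s d - Poly_Mapping.single t c"
    unfolding const_mult_monomial[symmetric] by (simp add: algebra_simps)
  finally have mem: "Poly_Mapping.single s d - Poly_Mapping.single t c \<in> I" .
  have "t \<in> Poly_Mapping.keys (Poly_Mapping.single s d - Poly_Mapping.single t c)"
    using \<open>s \<noteq> t\<close> \<open>c \<noteq> 0\<close> by (simp add: in_keys_iff lookup_minus lookup_single when_def)
  from monomial_mem_if_key[OF I mem this] assms(3) show False by simp
qed

section \<open>The lattice ideal\<close>

text \<open>Dividing by the greatest common divisor of the two monomials leaves a generator.\<close>

lemma binomial_mem_lattice_ideal:
  assumes "int_exp u - int_exp v \<in> L"
  shows "monomial u - monomial v \<in> (lattice_ideal L :: ('k :: comm_ring_1, 'n :: finite) mpoly set)"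
proof -
  define r :: "nat ^ 'n" where "r = (\<chi> i. min (u $ i) (v $ i))"
  let ?l = "int_exp u - int_exp v"
  have "u = r + pos_part ?l" "v = r + neg_part ?l"
    by (auto simp: vec_eq_iff r_def pos_part_def neg_part_def int_exp_def)
  then have "monomial u - monomial v =
      (monomial r * (monomial (pos_part ?l) - monomial (neg_part ?l)) :: ('k, 'n) mpoly)"
    by (metis monomial_add right_diff_distrib)
  moreover have "monomial (pos_part ?l) - monomial (neg_part ?l) \<in> (lattice_ideal L :: ('k, 'n) mpoly set)"
    unfolding lattice_ideal_def using assms by (intro ideal.span_base) blast
  ultimately show ?thesis
    unfolding lattice_ideal_def using ideal.span_scale by simp
qed

text \<open>A linear form that will vanish on the lattice ideal; \<open>t\<close> only represents
  its degree class.\<close>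

definition class_sum :: "(int ^ 'n) set \<Rightarrow> nat ^ 'n \<Rightarrow> ('k :: comm_ring_1, 'n) mpoly \<Rightarrow> 'k" where
  "class_sum L t f = (\<Sum>u\<in>Poly_Mapping.keys f. if deg L u = deg L t then Poly_Mapping.lookup f u else 0)"

lemma class_sum_superset:
  assumes "finite A" "Poly_Mapping.keys f \<subseteq> A"
  shows "class_sum L t f = (\<Sum>u\<in>A. if deg L u = deg L t then Poly_Mapping.lookup f u else 0)"
  unfolding class_sum_def using assms
  by (intro sum.mono_neutral_left) (auto simp: in_keys_iff)

lemma class_sum_add: "class_sum L t (f + g) = class_sum L t f + class_sum L t g"
proof -
  let ?A = "Poly_Mapping.keys f \<union> Poly_Mapping.keys g"
  have "class_sum L t h = (\<Sum>u\<in>?A. if deg L u = deg L t then Poly_Mapping.lookup h u else 0)"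
    if "h \<in> {f, g, f + g}" for h
    using that Poly_Mapping.keys_add[of f g] by (intro class_sum_superset) auto
  then show ?thesis
    by (auto simp: lookup_add simp flip: sum.distrib intro!: sum.cong)
qed

lemma class_sum_zero [simp]: "class_sum L t 0 = 0"
  by (simp add: class_sum_def)

lemma class_sum_sum: "class_sum L t (sum f A) = (\<Sum>a\<in>A. class_sum L t (f a))"
  by (induction A rule: infinite_finite_induct) (simp_all add: class_sum_add)

lemma class_sum_single:
  "class_sum L t (Poly_Mapping.single u c) = (if deg L u = deg L t then c else 0)"
  using class_sum_superset[of "{u}" "Poly_Mapping.single u c"] by (simp add: lookup_single)

text \<open>Multiplication by a monomial shifts degree classes, so the sum is \<open>c\<close> times
  a class sum of \<open>f\<close>, or empty if no exponent is shifted into the class of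
  \<open>t\<close>.\<close>

lemma class_sum_monomial_mult:
  assumes L: "zmod.subspace L" and zero: "\<And>t. class_sum L t f = 0"
  shows "class_sum L t (Poly_Mapping.single a c * f) = 0"
proof -
  let ?l = "Poly_Mapping.lookup f"
  have "Poly_Mapping.single a c * f =
      (\<Sum>u\<in>Poly_Mapping.keys f. Poly_Mapping.single a c * Poly_Mapping.single u (?l u))"
    by (subst (1) sum_single[of f, symmetric]) (simp only: sum_distrib_left)
  also have "class_sum L t \<dots> =
      (\<Sum>u\<in>Poly_Mapping.keys f. if deg L (a + u) = deg L t then c * ?l u else 0)"
    by (simp add: class_sum_sum class_sum_single mult_single)
  also have "\<dots> = 0"
  proof (cases "\<exists>u. deg L (a + u) = deg L t")
    case True
    then obtain v where v: "deg L (a + v) = deg L t" by blast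
    have "deg L (a + u) = deg L t \<longleftrightarrow> deg L u = deg L v" for u
    proof -
      have "int_exp (a + u) - int_exp (a + v) = int_exp u - int_exp v"
        by (simp add: vec_eq_iff int_exp_def)
      then show ?thesis
        using deg_eq_iff[OF L, of "a + u" "a + v"] deg_eq_iff[OF L, of u v] v by simp
    qed
    then have "(\<Sum>u\<in>Poly_Mapping.keys f. if deg L (a + u) = deg L t then c * ?l u else 0)
        = c * class_sum L v f"
      unfolding class_sum_def sum_distrib_left by (intro sum.cong) auto
    with zero show ?thesis by simp
  qed simp
  finally show ?thesis .
qed

text \<open>Vanishing of all class sums defines an ideal, and the coefficients 1 and -1 of a
  generating binomial belong to the same class.\<close>

lemma class_sum_lattice_ideal:
  fixes f :: "('k :: comm_ring_1, 'n :: finite) mpoly"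
  assumes L: "zmod.subspace L" and "f \<in> lattice_ideal L"
  shows "class_sum L t f = 0"
proof -
  let ?Z = "{f :: ('k, 'n) mpoly. \<forall>t. class_sum L t f = 0}"
  have "ideal.subspace ?Z"
  proof (rule ideal.subspaceI)
    show "c * f \<in> ?Z" if "f \<in> ?Z" for c f
    proof -
      have "c * f = (\<Sum>a\<in>Poly_Mapping.keys c. Poly_Mapping.single a (Poly_Mapping.lookup c a) * f)"
        by (subst (1) sum_single[of c, symmetric]) (simp only: sum_distrib_right)
      with that show ?thesis
        by (simp add: class_sum_sum class_sum_monomial_mult[OF L])
    qed
  qed (simp_all add: class_sum_add)
  moreover have "monomial (pos_part u) - monomial (neg_part u) \<in> ?Z" if "u \<in> L" for u
  proof -
    have "int_exp (pos_part u) - int_exp (neg_part u) = u"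
      by (simp add: vec_eq_iff int_exp_def pos_part_def neg_part_def)
    with that have "deg L (pos_part u) = deg L (neg_part u)"
      using deg_eq_iff[OF L] by simp
    moreover have "monomial (pos_part u) - monomial (neg_part u) =
        Poly_Mapping.single (pos_part u) (1 :: 'k) + Poly_Mapping.single (neg_part u) (- 1)"
      by (simp add: monomial_def single_uminus)
    ultimately show ?thesis
      by (simp add: class_sum_add class_sum_single)
  qed
  ultimately have "lattice_ideal L \<subseteq> ?Z"
    unfolding lattice_ideal_def by (intro ideal.span_minimal) auto
  with assms(2) show ?thesis by blast
qed

section \<open>Initial forms and the initial ideal\<close>

lemma initial_form_binomial:
  fixes u v :: "nat ^ 'n :: finite"
  assumes "weight w v < weight w u"
  shows "initial_form w (monomial u - monomial v) = (monomial u :: ('k :: comm_ring_1, 'n) mpoly)"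
proof -
  let ?f = "monomial u - monomial v :: ('k, 'n) mpoly"
  have "u \<noteq> v" using assms by auto
  then have keys: "Poly_Mapping.keys ?f = {u, v}" and lookup: "Poly_Mapping.lookup ?f u = 1"
    by (auto simp: monomial_def in_keys_iff lookup_minus lookup_single when_def split: if_splits)
  have "{x \<in> {u, v}. \<forall>y\<in>{u, v}. weight w y \<le> weight w x} = {u}"
    using assms by auto
  then show ?thesis
    by (simp add: initial_form_def keys lookup) (simp add: monomial_def)
qed

text \<open>A generator of \<open>I\<close> is the initial form of its difference with the standard
  monomial of its degree. Conversely, if an exponent of maximal weight in an element
  \<open>f\<close> of the lattice ideal were standard, it would be the only exponent of
  \<open>f\<close> in its degree, and the class sum there would be its nonzero coefficient.\<close>

lemma eq_initial_ideal:
  fixes I :: "('k :: field, 'n :: finite) mpoly set"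
  assumes L: "zmod.subspace L" and I: "monomial_L_graded_ideal L I"
    and w: "\<And>s u. monomial s \<notin> I \<Longrightarrow> monomial u \<in> I \<Longrightarrow> deg L u = deg L s \<Longrightarrow>
      weight w s < weight w u"
  shows "I = initial_ideal w (lattice_ideal L)"
proof
  obtain M where M: "I = ideal.span (monomial ` M)"
    using I by (auto simp: monomial_L_graded_ideal_def)
  show "I \<subseteq> initial_ideal w (lattice_ideal L)"
    unfolding M initial_ideal_def
  proof (intro ideal.span_minimal ideal.subspace_span subsetI)
    fix f :: "('k, 'n) mpoly"
    assume "f \<in> monomial ` M"
    then obtain m where m: "f = monomial m" "monomial m \<in> I"
      using M by (auto intro: ideal.span_base)
    obtain s where s: "monomial s \<notin> I" "deg L s = deg L m"
      using standard_exists[OF I] by blast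
    have "weight w s < weight w m"
      using w[OF s(1) m(2)] s(2) by simp
    let ?g = "monomial m - monomial s :: ('k, 'n) mpoly"
    have "initial_form w ?g = f"
      using initial_form_binomial[OF \<open>weight w s < weight w m\<close>] m by simp
    moreover have "?g \<in> lattice_ideal L"
      using s(2) deg_eq_iff[OF L, of m s] by (intro binomial_mem_lattice_ideal) simp
    moreover have "?g \<noteq> 0"
      using s(1) m(2) by auto
    ultimately show "f \<in> ideal.span {initial_form w f | f. f \<in> lattice_ideal L \<and> f \<noteq> 0}"
      by (intro ideal.span_base) blast
  qed
  show "initial_ideal w (lattice_ideal L) \<subseteq> I"
    unfolding initial_ideal_def
  proof (intro ideal.span_minimal subsetI)
    fix h :: "('k, 'n) mpoly"
    assume "h \<in> {initial_form w f | f. f \<in> lattice_ideal L \<and> f \<noteq> 0}"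
    then obtain f where f: "f \<in> lattice_ideal L" "h = initial_form w f" by blast
    have "monomial u \<in> I" if u: "u \<in> Poly_Mapping.keys f"
      and max: "\<forall>v\<in>Poly_Mapping.keys f. weight w v \<le> weight w u" for u
    proof (rule ccontr)
      assume std: "monomial u \<notin> I"
      \<comment> \<open>Another exponent of this degree would be nonstandard by uniqueness, hence
        heavier than \<open>u\<close>.\<close>
      have "v = u" if "v \<in> Poly_Mapping.keys f" "deg L v = deg L u" for v
        using standard_unique[OF I _ std that(2)] w[OF std _ that(2)] max that(1)
        by (meson not_le)
      then have "class_sum L u f = (\<Sum>v\<in>{u}. if deg L v = deg L u then Poly_Mapping.lookup f v else 0)"
        unfolding class_sum_def using u by (intro sum.mono_neutral_right) auto
      with class_sum_lattice_ideal[OF L f(1)] u show False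
        by (simp add: in_keys_iff)
    qed
    then show "h \<in> I"
      unfolding f(2) initial_form_def const_mult_monomial[symmetric] M
      by (intro ideal.span_sum ideal.span_scale) (simp add: M)
  qed (simp add: M)
qed

section \<open>Coordinates on a lattice of rank two\<close>

lemma rank_two_basis:
  fixes L :: "(int ^ 'n) set"
  assumes "has_rank L 2"
  obtains a b where "L = {x *s a + y *s b | x y. True}"
    "\<And>x y. x *s a + y *s b = 0 \<Longrightarrow> x = 0 \<and> y = 0"
proof -
  obtain B where B: "card B = 2" "zmod.independent B" "zmod.span B = L"
    using assms by (auto simp: has_rank_def)
  then obtain a b where ab: "B = {a, b}" "a \<noteq> b"
    by (auto simp: card_2_iff)
  have "v \<in> zmod.span {a, b} \<longleftrightarrow> (\<exists>x y. v = x *s a + y *s b)" for v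
  proof -
    have "v \<in> zmod.span {a, b} \<longleftrightarrow> (\<exists>x y. v - x *s a = y *s b)"
      by (auto simp: zmod.span_breakdown_eq zmod.span_singleton)
    then show ?thesis
      by (simp add: algebra_simps)
  qed
  then have "L = {x *s a + y *s b | x y. True}"
    using B(3) ab(1) by auto
  moreover have "x = 0 \<and> y = 0" if "x *s a + y *s b = 0" for x y
  proof -
    let ?u = "\<lambda>v. if v = a then x else y"
    have sum: "(\<Sum>v\<in>{a, b}. ?u v *s v) = 0"
      using ab(2) that by simp
    have "?u v = 0" if "v \<in> {a, b}" for v
      using zmod.independentD[OF B(2) _ _ sum that] ab(1) by simp
    from this[of a] this[of b] show ?thesis
      using ab(2) by simp
  qed
  ultimately show thesis by (rule that)
qed

lemma nonzero_minor:
  fixes a b :: "int ^ 'n"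
  assumes indep: "\<And>x y. x *s a + y *s b = 0 \<Longrightarrow> x = 0 \<and> y = 0"
  obtains i j where "a $ i * b $ j - a $ j * b $ i \<noteq> 0"
proof -
  have "a \<noteq> 0"
    using indep[of 1 0] by auto
  then obtain i where i: "a $ i \<noteq> 0"
    by (auto simp: vec_eq_iff)
  show thesis
  proof (rule ccontr)
    assume "\<not> thesis"
    with that have "a $ i * b $ j - a $ j * b $ i = 0" for j
      by blast
    then have "(- b $ i) *s a + (a $ i) *s b = 0"
      by (simp add: vec_eq_iff algebra_simps)
    with indep i show False by blast
  qed
qed

text \<open>Cramer's rule for a nonzero 2 by 2 minor \<open>m\<close> extends the functional from
  the lattice up to a factor. One factor \<open>m\<close> clears denominators, the second makes the
  multiple positive.\<close>

lemma extend_functional: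
  fixes a b :: "int ^ 'n"
  assumes indep: "\<And>x y. x *s a + y *s b = 0 \<Longrightarrow> x = 0 \<and> y = 0"
  obtains w k where "0 < k" "\<And>x y. (\<Sum>i\<in>UNIV. w $ i * (x *s a + y *s b) $ i) = k * app f (x, y)"
proof -
  obtain i j where ij: "a $ i * b $ j - a $ j * b $ i \<noteq> 0"
    using nonzero_minor[OF indep] .
  define m where "m = a $ i * b $ j - a $ j * b $ i"
  define p q where "p = m * (fst f * b $ j - snd f * a $ j)" and "q = m * (snd f * a $ i - fst f * b $ i)"
  define w :: "int ^ 'n" where "w = (\<chi> k. (if k = i then p else 0) + (if k = j then q else 0))"
  have w_sum: "(\<Sum>k\<in>UNIV. w $ k * v $ k) = p * v $ i + q * v $ j" for v
    by (simp add: w_def distrib_right sum.distrib if_distrib[of "\<lambda>z. z * _"] cong: if_cong)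
  have "(\<Sum>k\<in>UNIV. w $ k * (x *s a + y *s b) $ k) = m * m * app f (x, y)" for x y
    unfolding w_sum
    unfolding p_def q_def m_def app_def vector_add_component vector_smult_component fst_conv snd_conv
    by algebra
  moreover have "0 < m * m"
    using ij[folded m_def] by (metis mult_eq_0_iff order_le_less zero_le_square)
  ultimately show thesis
    using that by blast
qed

text \<open>\<open>St\<close> stands for the standard exponents. In coordinates on \<open>L\<close>
  they give an instance of \<open>planar_choice\<close>, whose positive functional extends to the
  desired weight.\<close>

lemma weight_minimized_at_standard:
  fixes L :: "(int ^ 'n) set" and St :: "(nat ^ 'n) set"
  assumes "has_rank L 2"
    and downward: "\<And>u v. v \<in> St \<Longrightarrow> u \<le> v \<Longrightarrow> u \<in> St"
    and ex: "\<And>u. \<exists>s\<in>St. int_exp s - int_exp u \<in> L"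
    and unique: "\<And>s t. s \<in> St \<Longrightarrow> t \<in> St \<Longrightarrow> int_exp s - int_exp t \<in> L \<Longrightarrow> s = t"
  obtains w where "\<And>s u. s \<in> St \<Longrightarrow> u \<notin> St \<Longrightarrow> int_exp u - int_exp s \<in> L \<Longrightarrow> weight w s < weight w u"
proof -
  obtain a b where L: "L = {x *s a + y *s b | x y. True}"
    and indep: "\<And>x y. x *s a + y *s b = 0 \<Longrightarrow> x = 0 \<and> y = 0"
    by (rule rank_two_basis[OF assms(1)]) (rule that)
  define vec where "vec p = fst p *s a + snd p *s b" for p
  have vec_mem: "vec p \<in> L" for p
    by (auto simp: L vec_def)
  have vec_ex: "\<exists>p. l = vec p" if "l \<in> L" for l
    using that by (auto simp: L vec_def)
  have vec_add: "vec (p + q) = vec p + vec q" and vec_diff: "vec (p - q) = vec p - vec q"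
    and vec_minus: "vec (- p) = - vec p" for p q
    by (simp_all add: vec_def vec_eq_iff algebra_simps)
  have vec_0: "p = 0" if "vec p = 0" for p
    using indep[of "fst p" "snd p"] that by (simp add: vec_def prod_eq_iff)
  \<comment> \<open>The coordinate functions of the ambient space, restricted to the
    lattice.\<close>
  define F where "F = range (\<lambda>i. (a $ i, b $ i))"
  have app_F: "app (a $ i, b $ i) p = vec p $ i" for i p
    by (simp add: app_def vec_def algebra_simps)
  \<comment> \<open>These are the differences between an exponent and a different, standard exponent
    of its class: cancelling common parts leaves the negative part, which stays standard.\<close>
  define D where "D = {d. d \<noteq> 0 \<and> neg_part (vec d) \<in> St}"
  interpret planar_choice F D
  proof
    fix d
    assume "d \<in> D"
    show "- d \<notin> D"
    proof
      assume "- d \<in> D"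
      \<comment> \<open>The negative part of \<open>vec (- d)\<close> is the positive part of
        \<open>vec d\<close>. Both parts would be standard and of the same class, hence
        equal.\<close>
      have "int_exp (neg_part (vec (- d))) - int_exp (neg_part (vec d)) = vec d"
        by (simp add: vec_minus vec_eq_iff int_exp_def neg_part_def)
      then have "neg_part (vec (- d)) = neg_part (vec d)"
        using unique[of "neg_part (vec (- d))" "neg_part (vec d)"] \<open>d \<in> D\<close> \<open>- d \<in> D\<close> vec_mem
        by (simp add: D_def)
      with \<open>int_exp (neg_part (vec (- d))) - int_exp (neg_part (vec d)) = vec d\<close>
      have "vec d = 0" by simp
      with vec_0 \<open>d \<in> D\<close> show False
        by (simp add: D_def)
    qed
  next
    fix d v
    assume d: "d \<in> D" "v \<noteq> 0" and le: "\<And>f. f \<in> F \<Longrightarrow> min 0 (app f d) \<le> app f v"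
    have "nat (- vec v $ i) \<le> nat (- vec d $ i)" for i
    proof -
      have "min 0 (vec d $ i) \<le> vec v $ i"
        using le[of "(a $ i, b $ i)"] by (simp add: F_def app_F)
      then show ?thesis by arith
    qed
    then have "neg_part (vec v) \<le> neg_part (vec d)"
      by (simp add: less_eq_vec_def neg_part_def)
    with d downward show "v \<in> D"
      by (auto simp: D_def)
  next
    fix V :: "(int \<times> int) set"
    assume V: "finite V" "V \<noteq> {}"
    \<comment> \<open>Moving the coordinatewise minimum \<open>m\<close> of \<open>V\<close> to the
      origin turns the points of \<open>V\<close> into exponents of one class. The standard exponent
      \<open>s\<close> of this class, moved back, is the chosen point \<open>q\<close>.\<close>
    define m where "m i = Min ((\<lambda>x. vec x $ i) ` V)" for i
    have m_le: "m i \<le> vec x $ i" if "x \<in> V" for x i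
      unfolding m_def using that V by (intro Min_le) auto
    have m_attained: "\<exists>x\<in>V. vec x $ i = m i" for i
      using Min_in[of "(\<lambda>x. vec x $ i) ` V"] V unfolding m_def by fastforce
    obtain z where z: "z \<in> V" using V by blast
    obtain s where s: "s \<in> St" "int_exp s - int_exp (\<chi> i. nat (vec z $ i - m i)) \<in> L"
      using ex by blast
    then obtain p where p: "int_exp s - int_exp (\<chi> i. nat (vec z $ i - m i)) = vec p"
      using vec_ex by blast
    define q where "q = z + p"
    have q: "vec q $ i = int (s $ i) + m i" for i
    proof -
      have "vec p $ i = int (s $ i) - (vec z $ i - m i)"
        using p[symmetric] m_le[OF z, of i] by (simp add: int_exp_def)
      then show ?thesis by (simp add: q_def vec_add)
    qed
    \<comment> \<open>Coordinatewise \<open>v\<close> is at least \<open>m\<close> and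
      \<open>q\<close> is \<open>s + m\<close>, so the negative part of \<open>v - q\<close> is at
      most \<open>s\<close>.\<close>
    have "v - q \<in> D" if "v \<in> V" "v \<noteq> q" for v
    proof -
      have "nat (- (vec v $ i - (int (s $ i) + m i))) \<le> s $ i" for i
        using m_le[OF that(1), of i] by simp
      then have "neg_part (vec (v - q)) \<le> s"
        by (simp add: less_eq_vec_def neg_part_def vec_diff q)
      with downward[OF s(1)] that(2) show ?thesis
        by (simp add: D_def)
    qed
    moreover have "\<exists>x\<in>V. app f x \<le> app f q" if f: "f \<in> F" for f
    proof -
      obtain i where "f = (a $ i, b $ i)"
        using f by (auto simp: F_def)
      moreover obtain x where "x \<in> V" "vec x $ i = m i"
        using m_attained by blast
      ultimately show ?thesis
        by (intro bexI[of _ x]) (simp_all add: app_F q)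
    qed
    ultimately show "\<exists>q. (\<forall>f\<in>F. \<exists>x\<in>V. app f x \<le> app f q) \<and> (\<forall>v\<in>V. v \<noteq> q \<longrightarrow> v - q \<in> D)"
      by blast
  qed
  have "finite F" by (simp add: F_def)
  moreover have "v = 0" if "\<forall>f\<in>F. app f v = 0" for v
  proof (rule vec_0)
    show "vec v = 0"
      unfolding vec_eq_iff using that by (auto simp: F_def app_F)
  qed
  ultimately obtain f where f: "\<And>d. d \<in> D \<Longrightarrow> 0 < app f d"
    by (rule positive_functional) (assumption, rule that)
  obtain w k where w: "0 < k" "\<And>x y. (\<Sum>i\<in>UNIV. w $ i * (x *s a + y *s b) $ i) = k * app f (x, y)"
    by (rule extend_functional[where a = a and b = b and f = f]) (erule indep, rule that)
  have "weight w s < weight w u" if su: "s \<in> St" "u \<notin> St" "int_exp u - int_exp s \<in> L" for s u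
  proof -
    obtain d where d: "int_exp u - int_exp s = vec d"
      using vec_ex[OF su(3)] by blast
    have "neg_part (vec d) \<le> s"
      unfolding d[symmetric] by (simp add: less_eq_vec_def neg_part_def int_exp_def nat_le_iff)
    moreover have "d \<noteq> 0"
    proof
      assume "d = 0"
      with d have "u = s"
        by (simp add: vec_def vec_eq_iff int_exp_def)
      with su show False by simp
    qed
    ultimately have "d \<in> D"
      using downward[OF su(1)] by (simp add: D_def)
    have "weight w u - weight w s = (\<Sum>i\<in>UNIV. w $ i * (int_exp u - int_exp s) $ i)"
      by (simp add: weight_def int_exp_def right_diff_distrib sum_subtractf)
    also have "\<dots> = k * app f d"
      using w(2)[of "fst d" "snd d"] unfolding d vec_def by simp
    also have "\<dots> > 0"
      using w(1) f[OF \<open>d \<in> D\<close>] by simp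
    finally show ?thesis by simp
  qed
  with that show thesis by blast
qed

theorem theorem3p1:
  fixes L :: "(int ^ 'n) set"
    and I :: "('k :: field, 'n) mpoly set"
  assumes "infinite (UNIV :: 'k set)"
    and "zmod.subspace L"
    and "has_rank L 2"
    and "monomial_L_graded_ideal L I"
  shows "\<exists>w :: int ^ 'n. I = initial_ideal w (lattice_ideal L)"
proof -
  have deg: "deg L u = deg L v \<longleftrightarrow> int_exp u - int_exp v \<in> L" for u v
    using deg_eq_iff[OF assms(2)] .
  have subspace: "ideal.subspace I"
    using assms(4) by (auto simp: monomial_L_graded_ideal_def)
  obtain w where "\<And>s u. s \<in> {u. monomial u \<notin> I} \<Longrightarrow> u \<notin> {u. monomial u \<notin> I} \<Longrightarrow>
      int_exp u - int_exp s \<in> L \<Longrightarrow> weight w s < weight w u"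
  proof (rule weight_minimized_at_standard[OF assms(3), of "{u. monomial u \<notin> I}"])
    show "u \<in> {u. monomial u \<notin> I}" if "v \<in> {u. monomial u \<notin> I}" "u \<le> v" for u v
      using monomial_mem_upward[OF subspace _ that(2)] that(1) by auto
    show "\<exists>s\<in>{u. monomial u \<notin> I}. int_exp s - int_exp u \<in> L" for u
      using standard_exists[OF assms(4), of u] by (auto simp: deg)
    show "s = t" if "s \<in> {u. monomial u \<notin> I}" "t \<in> {u. monomial u \<notin> I}" "int_exp s - int_exp t \<in> L"
      for s t
      using standard_unique[OF assms(4)] that by (simp add: deg)
  qed blast
  then have "I = initial_ideal w (lattice_ideal L)"
    by (intro eq_initial_ideal[OF assms(2,4)]) (simp add: deg)
  then show ?thesis by blast
qed

end
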